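(* Consider a system whose communication graph $G$ is a simple cycle, and let $a$ and $b$ be its two rings. Let $N(a)$ and $N(b)$ be the numbers of robots in $a$ and $b$, respectively, in a synchronized communication system on $G$ (before any robot leaves). Then the isolation-resilience of $G$ is $\min\{N(a),N(b)\}-1$.
   Context: Model. A system consists of pairwise disjoint unit circles $C_1,\dots,C_n$ in the plane (trajectories) and a communication range $r>0$. Its communication graph $G$ has vertex set $\{C_1,\dots,C_n\}$, $C_i,C_j$ adjacent iff the distance between their centres is at most $2+r$. Positions on a circle are angles (mod $2\pi$). For an edge $(i,j)$, the link position $\phi_{ij}$ is the angle of the point of $C_i$ closest to $C_j$. A schedule $F=(f,g)$ assigns each circle a starting angle $f(C_i)$ and direction $g(C_i)\in\{1,-1\}$; a robot following it on $C_i$ is at $f(C_i)+g(C_i)2\pi t$ at time $t$. $F$ is a synchronization schedule if $g(C_i)=-g(C_j)$ for adjacent circles and robots following $F$ on adjacent $C_i,C_j$ are at $\phi_{ij},\phi_{ji}$ at exactly the same times. A synchronized communication system (SCS) on $G$ consists of $n$ robots, initially one per circle, following a synchronization schedule, with the switching rule: when a robot on $C_i$ reaches $\phi_{ij}$ and $C_j$ is empty, it instantly passes to $C_j$ and follows the schedule of $C_j$; if $C_j$ has a robot, they meet and each stays on its circle. A partial SCS arises by letting some robots leave (possibly at different times); remaining robots never leave. A surviving robot $u$ starves if every time $u$ arrives at a link position $\phi_{ij}$ of its current circle $C_i$, the circle $C_j$ is empty; the system is in starvation state if all surviving robots starve. The isolation-resilience of $G$ is the largest $k$ such that, whichever $k$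 robots leave an SCS on $G$, the system does not fall into starvation state. Rings. Given the directions $g$, trace a point moving along a circle $C_i$ in direction $g(C_i)$; whenever it reaches a link position $\phi_{ij}$ of its current circle, it passes to $C_j$ at $\phi_{ji}$ and continues in direction $g(C_j)$. The closed curve traced is a ring; the circles decompose into rings overlapping only at link positions. A robot is in a ring if it lies on a point of it. When $G$ is a cycle there are exactly two rings. *)

theory Defs
  imports "HOL-Analysis.Analysis"
begin

text \<open>A system: circles C_0,...,C_{n-1} with centres c i (complex plane), all of radius 1,
  and communication range r.  Points of circle C_i are represented as pairs (i, u) with u a
  unit complex number (the point c i + u); the angle theta corresponds to u = cis theta.\<close>

definition disjoint_unit_circles :: "nat \<Rightarrow> (nat \<Rightarrow> complex) \<Rightarrow> bool" where
  "disjoint_unit_circles n c \<longleftrightarrow> (\<forall>i<n. \<forall>j<n. i \<noteq> j \<longrightarrow> 2 < cmod (c i - c j))"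

definition adj :: "nat \<Rightarrow> (nat \<Rightarrow> complex) \<Rightarrow> real \<Rightarrow> nat \<Rightarrow> nat \<Rightarrow> bool" where
  "adj n c r i j \<longleftrightarrow> i < n \<and> j < n \<and> i \<noteq> j \<and> cmod (c i - c j) \<le> 2 + r"

definition is_cycle_graph :: "nat \<Rightarrow> (nat \<Rightarrow> nat \<Rightarrow> bool) \<Rightarrow> bool" where
  "is_cycle_graph n E \<longleftrightarrow> 3 \<le> n \<and>
     (\<exists>\<sigma>. bij_betw \<sigma> {..<n} {..<n} \<and>
        (\<forall>i j. E i j \<longleftrightarrow> (\<exists>m<n. (i = \<sigma> m \<and> j = \<sigma> ((m + 1) mod n)) \<or>
                                   (j = \<sigma> m \<and> i = \<sigma> ((m + 1) mod n)))))"

text \<open>Link position phi_ij: the point of C_i closest to C_j, i.e. c i + sgn (c j - c i).\<close>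
definition lk :: "(nat \<Rightarrow> complex) \<Rightarrow> nat \<Rightarrow> nat \<Rightarrow> complex" where
  "lk c i j = sgn (c j - c i)"

definition pos :: "(nat \<Rightarrow> real) \<Rightarrow> (nat \<Rightarrow> int) \<Rightarrow> nat \<Rightarrow> real \<Rightarrow> complex" where
  "pos f g i t = cis (f i + of_int (g i) * 2 * pi * t)"

definition sync_schedule ::
  "nat \<Rightarrow> (nat \<Rightarrow> complex) \<Rightarrow> real \<Rightarrow> (nat \<Rightarrow> real) \<Rightarrow> (nat \<Rightarrow> int) \<Rightarrow> bool" where
  "sync_schedule n c r f g \<longleftrightarrow>
     (\<forall>i<n. g i = 1 \<or> g i = -1) \<and>
     (\<forall>i j. adj n c r i j \<longrightarrow>
        g i = - g j \<and> (\<forall>t::real. pos f g i t = lk c i j \<longleftrightarrow> pos f g j t = lk c j i))"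

definition fdist :: "real \<Rightarrow> complex \<Rightarrow> complex \<Rightarrow> real" where
  "fdist \<sigma> u v = (THE s. 0 < s \<and> s \<le> 2 * pi \<and> v = u * cis (\<sigma> * s))"

text \<open>Darts (i,k): the arc of C_i that starts at the link position phi_ik (towards C_k) and
  runs in direction g i up to the next link position phi_ij of C_i; the tracing point then
  passes to C_j at phi_ji, i.e. continues on dart (j,i).\<close>
definition dart :: "nat \<Rightarrow> (nat \<Rightarrow> complex) \<Rightarrow> real \<Rightarrow> nat \<times> nat \<Rightarrow> bool" where
  "dart n c r d \<longleftrightarrow> adj n c r (fst d) (snd d)"

definition next_link ::
  "nat \<Rightarrow> (nat \<Rightarrow> complex) \<Rightarrow> real \<Rightarrow> (nat \<Rightarrow> int) \<Rightarrow> nat \<Rightarrow> nat \<Rightarrow> nat \<Rightarrow> bool" where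
  "next_link n c r g i k j \<longleftrightarrow> adj n c r i k \<and> adj n c r i j \<and>
     (\<forall>j'. adj n c r i j' \<longrightarrow>
        fdist (of_int (g i)) (lk c i k) (lk c i j) \<le> fdist (of_int (g i)) (lk c i k) (lk c i j'))"

definition dart_next ::
  "nat \<Rightarrow> (nat \<Rightarrow> complex) \<Rightarrow> real \<Rightarrow> (nat \<Rightarrow> int) \<Rightarrow> ((nat \<times> nat) \<times> (nat \<times> nat)) set" where
  "dart_next n c r g = {((i, k), (j, i)) | i k j. next_link n c r g i k j}"

definition arc ::
  "nat \<Rightarrow> (nat \<Rightarrow> complex) \<Rightarrow> real \<Rightarrow> (nat \<Rightarrow> int) \<Rightarrow> nat \<times> nat \<Rightarrow> (nat \<times> complex) set" where
  "arc n c r g d = {(fst d, lk c (fst d) (snd d) * cis (of_int (g (fst d)) * s)) | s j.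
      next_link n c r g (fst d) (snd d) j \<and> 0 \<le> s \<and>
      s \<le> fdist (of_int (g (fst d))) (lk c (fst d) (snd d)) (lk c (fst d) j)}"

definition ring_darts ::
  "nat \<Rightarrow> (nat \<Rightarrow> complex) \<Rightarrow> real \<Rightarrow> (nat \<Rightarrow> int) \<Rightarrow> nat \<times> nat \<Rightarrow> (nat \<times> nat) set" where
  "ring_darts n c r g d = {d'. (d, d') \<in> (dart_next n c r g \<union> (dart_next n c r g)\<inverse>)\<^sup>*}"

definition rings ::
  "nat \<Rightarrow> (nat \<Rightarrow> complex) \<Rightarrow> real \<Rightarrow> (nat \<Rightarrow> int) \<Rightarrow> (nat \<times> complex) set set" where
  "rings n c r g = {\<Union> (arc n c r g ` ring_darts n c r g d) | d. dart n c r d}"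

text \<open>Number of robots lying in the point set R at time t in the SCS (before any robot
  leaves: robot u stays on circle u, since all circles are occupied).\<close>
definition robots_in ::
  "nat \<Rightarrow> (nat \<Rightarrow> real) \<Rightarrow> (nat \<Rightarrow> int) \<Rightarrow> (nat \<times> complex) set \<Rightarrow> real \<Rightarrow> nat" where
  "robots_in n f g R t = card {u. u < n \<and> (u, pos f g u t) \<in> R}"

definition generic_time ::
  "nat \<Rightarrow> (nat \<Rightarrow> complex) \<Rightarrow> real \<Rightarrow> (nat \<Rightarrow> real) \<Rightarrow> (nat \<Rightarrow> int) \<Rightarrow> real \<Rightarrow> bool" where
  "generic_time n c r f g t \<longleftrightarrow> (\<forall>i j. adj n c r i j \<longrightarrow> pos f g i t \<noteq> lk c i j)"

text \<open>Robots are 0..n-1, robot u starts on circle u.  A state maps each robot to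
  Some (its current circle) or None (has left).  A leave plan lv assigns to each leaving
  robot its leaving time.\<close>

type_synonym state = "nat \<Rightarrow> nat option"

definition init_state :: "nat \<Rightarrow> state" where
  "init_state n = (\<lambda>u. if u < n then Some u else None)"

definition after_leave :: "(nat \<Rightarrow> real option) \<Rightarrow> real \<Rightarrow> state \<Rightarrow> state" where
  "after_leave lv t x = (\<lambda>u. if (\<exists>\<tau>. lv u = Some \<tau> \<and> \<tau> \<le> t) then None else x u)"

definition occupied :: "state \<Rightarrow> nat \<Rightarrow> bool" where
  "occupied x j \<longleftrightarrow> (\<exists>v. x v = Some j)"

definition step ::
  "nat \<Rightarrow> (nat \<Rightarrow> complex) \<Rightarrow> real \<Rightarrow> (nat \<Rightarrow> real) \<Rightarrow> (nat \<Rightarrow> int) \<Rightarrow>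
   (nat \<Rightarrow> real option) \<Rightarrow> real \<Rightarrow> state \<Rightarrow> state" where
  "step n c r f g lv t x =
     (let y = after_leave lv t x in
      (\<lambda>u. case y u of
              None \<Rightarrow> None
            | Some i \<Rightarrow>
                (if \<exists>j. adj n c r i j \<and> pos f g i t = lk c i j \<and> \<not> occupied y j
                 then Some (SOME j. adj n c r i j \<and> pos f g i t = lk c i j \<and> \<not> occupied y j)
                 else Some i)))"

definition left_state :: "nat \<Rightarrow> (real \<Rightarrow> state) \<Rightarrow> real \<Rightarrow> state \<Rightarrow> bool" where
  "left_state n loc t x \<longleftrightarrow>
     (t = 0 \<and> x = init_state n) \<or>
     (0 < t \<and> (\<exists>\<epsilon>>0. \<forall>s. t - \<epsilon> < s \<and> s < t \<longrightarrow> loc s = x))"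

text \<open>loc t is the state at time t (after the events of time t); it is piecewise constant
  and at every time obeys the switching rule.\<close>
definition is_run ::
  "nat \<Rightarrow> (nat \<Rightarrow> complex) \<Rightarrow> real \<Rightarrow> (nat \<Rightarrow> real) \<Rightarrow> (nat \<Rightarrow> int) \<Rightarrow>
   (nat \<Rightarrow> real option) \<Rightarrow> (real \<Rightarrow> state) \<Rightarrow> bool" where
  "is_run n c r f g lv loc \<longleftrightarrow>
     (\<forall>t\<ge>0. (\<exists>\<epsilon>>0. \<forall>s. t \<le> s \<and> s < t + \<epsilon> \<longrightarrow> loc s = loc t) \<and>
            (\<exists>x. left_state n loc t x \<and> loc t = step n c r f g lv t x))"

definition starvation_from ::
  "nat \<Rightarrow> (nat \<Rightarrow> complex) \<Rightarrow> real \<Rightarrow> (nat \<Rightarrow> real) \<Rightarrow> (nat \<Rightarrow> int) \<Rightarrow>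
   (nat \<Rightarrow> real option) \<Rightarrow> (real \<Rightarrow> state) \<Rightarrow> real \<Rightarrow> bool" where
  "starvation_from n c r f g lv loc T \<longleftrightarrow>
     (\<forall>t\<ge>T. \<forall>x. left_state n loc t x \<longrightarrow>
        (\<forall>u i j. lv u = None \<and> after_leave lv t x u = Some i \<and> adj n c r i j \<and>
                 pos f g i t = lk c i j \<longrightarrow> \<not> occupied (after_leave lv t x) j))"

definition falls_into_starvation ::
  "nat \<Rightarrow> (nat \<Rightarrow> complex) \<Rightarrow> real \<Rightarrow> (nat \<Rightarrow> real) \<Rightarrow> (nat \<Rightarrow> int) \<Rightarrow>
   (nat \<Rightarrow> real option) \<Rightarrow> (real \<Rightarrow> state) \<Rightarrow> bool" where
  "falls_into_starvation n c r f g lv loc \<longleftrightarrow> (\<exists>T. starvation_from n c r f g lv loc T)"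

definition resilient_to :: "nat \<Rightarrow> (nat \<Rightarrow> complex) \<Rightarrow> real \<Rightarrow> nat \<Rightarrow> bool" where
  "resilient_to n c r k \<longleftrightarrow>
     (\<forall>f g. sync_schedule n c r f g \<longrightarrow>
       (\<forall>lv. dom lv \<subseteq> {..<n} \<and> card (dom lv) = k \<and> (\<forall>u \<tau>. lv u = Some \<tau> \<longrightarrow> 0 \<le> \<tau>) \<longrightarrow>
          (\<forall>loc. is_run n c r f g lv loc \<longrightarrow> \<not> falls_into_starvation n c r f g lv loc)))"

definition isolation_resilience :: "nat \<Rightarrow> (nat \<Rightarrow> complex) \<Rightarrow> real \<Rightarrow> nat" where
  "isolation_resilience n c r = Max {k. k \<le> n \<and> resilient_to n c r k}"

end

theory Submission
  imports Defs
begin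

text \<open>
  Imagine that meeting robots swap tokens.  Then a token always follows one of the two rings, in
  whichever way robots switch circles, and a token dies exactly when its holder leaves.  Two tokens
  of different rings meet again and again, while tokens of the same ring never meet.  So the system
  starves if and only if all tokens of one ring are dead.  The number of tokens of a ring is
  the length of the ring in units of \<open>2 * pi\<close>; reversing all directions exchanges the two lengths, and
  otherwise they do not depend on the schedule.
\<close>

text \<open>Tokens are never formalised. A robot that meets nobody moves exactly like its token, and
  both bounds only need such robots: in a run assumed to starve, every robot still present after the
  last departure is of this kind, and the run that refutes resilience consists of such robots alone.
  The cycle is unrolled to the integers and the crossing times to the real sequence
  \<open>A\<close>. A token is then given by an integer label \<open>k\<close>, which never changes
  while the token follows its ring. Labels differ by whole time units, that is by whole turns, and a
  lap takes \<open>N\<close> units, which is why a ring carries \<open>N\<close> tokens. A link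
  belongs to both rings, so the instants at links need a convention: states after an event go with
  intervals closed on the left, states before it with intervals closed on the right. Time is real
  and a run is known only through left limits and constancy to the right, so statements on runs are
  proved by induction on the reals.\<close>

section \<open>Induction on the reals, integer sequences, angles\<close>

text \<open>The infimum of the counterexamples satisfies \<open>P\<close> by \<open>base\<close> or
  \<open>left\<close>, and \<open>right\<close> then keeps the counterexamples away from it.\<close>

lemma real_interval_induct [consumes 1, case_names base right left]:
  fixes a t :: real
  assumes "a \<le> t"
    and base: "P a"
    and right: "\<And>t. a \<le> t \<Longrightarrow> P t \<Longrightarrow> \<exists>e>0. \<forall>u. t \<le> u \<and> u < t + e \<longrightarrow> P u"
    and left: "\<And>t. a < t \<Longrightarrow> (\<And>u. a \<le> u \<Longrightarrow> u < t \<Longrightarrow> P u) \<Longrightarrow> P t"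
  shows "P t"
proof (rule ccontr)
  assume "\<not> P t"
  define S where "S = {u. a \<le> u \<and> \<not> P u}"
  have ne: "S \<noteq> {}" and bdd: "bdd_below S"
    using \<open>\<not> P t\<close> \<open>a \<le> t\<close> by (auto simp: S_def intro: bdd_belowI[of _ a])
  have below: "P u" if "a \<le> u" "u < Inf S" for u
    using cInf_lower[OF _ bdd, of u] that by (auto simp: S_def)
  have "a \<le> Inf S"
    using ne by (intro cInf_greatest) (auto simp: S_def)
  then have "P (Inf S)"
    using base left[of "Inf S"] below by (metis order_le_less)
  then obtain e where e: "e > 0" "\<forall>u. Inf S \<le> u \<and> u < Inf S + e \<longrightarrow> P u"
    using right \<open>a \<le> Inf S\<close> by blast
  obtain u where "u \<in> S" "u < Inf S + e"
    using cInf_lessD[OF ne, of "Inf S + e"] e(1) by auto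
  moreover from this have "Inf S \<le> u"
    by (intro cInf_lower bdd)
  ultimately show False
    using e(2) unfolding S_def by blast
qed

lemma int_crossing:
  fixes Q :: "int \<Rightarrow> bool"
  assumes "\<not> Q l" "Q h" "l \<le> h"
  shows "\<exists>m. \<not> Q (m - 1) \<and> Q m"
proof -
  have "\<exists>j. Q (l + int j)"
    using assms by (intro exI[of _ "nat (h - l)"]) auto
  define j where "j = (LEAST j. Q (l + int j))"
  have Qj: "Q (l + int j)"
    unfolding j_def using \<open>\<exists>j. Q (l + int j)\<close> by (rule LeastI_ex)
  then have "j > 0"
    using assms(1) by (cases j) auto
  then have "\<not> Q (l + int (j - 1))"
    unfolding j_def by (intro not_less_Least) auto
  with Qj \<open>j > 0\<close> show ?thesis
    by (intro exI[of _ "l + int j"]) (auto simp: algebra_simps of_nat_diff)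
qed

lemma int_antidifference:
  fixes D :: "int \<Rightarrow> real"
  shows "\<exists>A. A 0 = a \<and> (\<forall>m. A m = A (m - 1) + D m)"
proof -
  \<comment> \<open>For every \<open>m\<close> at least one of the two sums is empty: the first
    serves positive, the second negative indices.\<close>
  define A where "A m = a + sum D {1..m} - sum D {m+1..0}" for m
  have "A m = A (m - 1) + D m" for m
  proof (cases "m \<ge> 1")
    case True
    then have "{1..m} = insert m {1..m-1}" by auto
    with True show ?thesis by (simp add: A_def)
  next
    case False
    then have "{m..0} = insert m {m+1..0}" by auto
    with False show ?thesis by (simp add: A_def)
  qed
  moreover have "A 0 = a"
    by (simp add: A_def)
  ultimately show ?thesis by blast
qed

text \<open>Counting the drops of size 1 amounts to adding up all drops. It is applied with
  \<open>h m\<close> the floor or ceiling of \<open>t - A m\<close>, where a drop marks a circle of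
  the ring.\<close>

lemma telescoping_card:
  fixes h :: "int \<Rightarrow> int"
  assumes "\<And>m. h (m - 1) - h m = 0 \<or> h (m - 1) - h m = 1"
    and "h (int n - 1) = h (- 1) - N"
  shows "int (card {m \<in> {0..<int n}. h (m - 1) - h m = 1}) = N"
proof -
  have tele: "(\<Sum>m\<in>{0..<int k}. h (m - 1) - h m) = h (-1) - h (int k - 1)" for k
  proof (induction k)
    case (Suc k)
    have "{0..<int (Suc k)} = insert (int k) {0..<int k}" by auto
    with Suc show ?case by simp
  qed simp
  have "int (card {m \<in> {0..<int n}. h (m - 1) - h m = 1}) =
      (\<Sum>m\<in>{0..<int n}. if h (m - 1) - h m = 1 then 1 else 0)"
    by (simp add: sum.If_cases Int_def)
  also have "\<dots> = (\<Sum>m\<in>{0..<int n}. h (m - 1) - h m)"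
    using assms(1) by (intro sum.cong refl) (metis of_int_1)
  finally show ?thesis
    using tele assms(2) by simp
qed

lemma cis_eq_cis_iff: "cis x = cis y \<longleftrightarrow> (\<exists>k::int. x = y + 2 * pi * of_int k)"
proof -
  have "cis x = cis y \<longleftrightarrow> sin x = sin y \<and> cos x = cos y"
    by (auto simp: complex_eq_iff)
  then show ?thesis
    by (simp only: sin_cos_eq_iff)
qed

lemma pos_eq_iff:
  assumes "g i = 1 \<or> g i = -1"
  shows "pos f g i t = pos f g i t' \<longleftrightarrow> t - t' \<in> \<int>"
proof -
  have "pos f g i t = pos f g i t' \<longleftrightarrow>
      (\<exists>k::int. 2 * pi * (of_int (g i) * (t - t')) = 2 * pi * of_int k)"
    unfolding pos_def cis_eq_cis_iff by (auto simp: algebra_simps)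
  also have "\<dots> \<longleftrightarrow> (\<exists>k::int. of_int (g i) * (t - t') = of_int k)"
    by simp
  also have "\<dots> \<longleftrightarrow> of_int (g i) * (t - t') \<in> \<int>"
    by (auto simp: Ints_def)
  also have "\<dots> \<longleftrightarrow> t - t' \<in> \<int>"
    using assms minus_in_Ints_iff[of "t - t'"] by auto
  finally show ?thesis .
qed

lemma pos_shift: "pos f g i (t + s) = pos f g i t * cis (of_int (g i) * (2 * pi * s))"
  by (simp add: pos_def cis_mult algebra_simps)

lemma pos_surj:
  assumes "g i = 1 \<or> g i = -1" "cmod z = 1"
  shows "\<exists>t. pos f g i t = z"
proof -
  have z: "z = cis (Arg z)"
    using assms(2) by (metis cis_Arg inverse_1 norm_zero scaleR_one sgn_div_norm zero_neq_one)
  have "pos f g i (of_int (g i) * (Arg z - f i) / (2 * pi)) = z"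
    using assms(1) by (subst (2) z) (auto simp: pos_def)
  then show ?thesis ..
qed

text \<open>Shows that the description in \<open>fdist\<close> is unique: two solutions differ by a
  multiple of \<open>2 * pi\<close> smaller than \<open>2 * pi\<close> in absolute value.\<close>

lemma fdist_eq:
  assumes "\<sigma> = 1 \<or> \<sigma> = -1" "cmod u = 1" "v = u * cis (\<sigma> * s)" "0 < s" "s \<le> 2 * pi"
  shows "fdist \<sigma> u v = s"
  unfolding fdist_def
proof (rule the_equality)
  fix s' assume s': "0 < s' \<and> s' \<le> 2 * pi \<and> v = u * cis (\<sigma> * s')"
  with assms have "cis (\<sigma> * s') = cis (\<sigma> * s)" by auto
  then obtain k :: int where "\<sigma> * s' = \<sigma> * s + 2 * pi * of_int k"
    unfolding cis_eq_cis_iff by blast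
  then have k: "s' - s = 2 * pi * of_int k \<or> s' - s = - (2 * pi * of_int k)"
    using assms(1) by auto
  have "\<bar>2 * pi * of_int k\<bar> < 2 * pi * 1"
    using k s' assms(4,5) by linarith
  then have "\<bar>of_int k :: real\<bar> < 1"
    by (simp add: abs_mult)
  then have "k = 0" by linarith
  with k show "s' = s" by simp
qed (intro conjI assms)

lemma after_leave_eq_Some_iff:
  "after_leave lv t x u = Some i \<longleftrightarrow> x u = Some i \<and> \<not> (\<exists>\<tau>. lv u = Some \<tau> \<and> \<tau> \<le> t)"
  by (simp add: after_leave_def)

lemma left_state_eventually:
  assumes "left_state n loc t x" "0 < t"
  shows "\<forall>\<^sub>F u in at_left t. loc u = x"
proof -
  obtain e where "e > 0" "\<forall>u. t - e < u \<and> u < t \<longrightarrow> loc u = x"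
    using assms by (auto simp: left_state_def)
  then show ?thesis
    by (auto simp: eventually_at_left_real intro!: eventually_at_leftI[of "t - e"])
qed

lemma left_stateI_eventually:
  assumes "\<forall>\<^sub>F u in at_left t. loc u = x" "0 < t"
  shows "left_state n loc t x"
proof -
  obtain b where "b < t" "\<forall>y>b. y < t \<longrightarrow> loc y = x"
    using assms(1) by (auto simp: eventually_at_left[of "t - 1"])
  then show ?thesis
    using assms(2) by (auto simp: left_state_def intro!: exI[of _ "t - b"])
qed

section \<open>The cycle unrolled to the integers\<close>

text \<open>Indexing by all integers makes \<open>s\<close> a covering of the cycle: different laps
  have different indices, and neighbours need no arithmetic modulo \<open>n\<close>.\<close>

locale cycle_graph =
  fixes n :: nat and c :: "nat \<Rightarrow> complex" and r :: real and s :: "int \<Rightarrow> nat"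
  assumes three_le_n: "3 \<le> n"
    and s_eq_iff: "s m = s m' \<longleftrightarrow> int n dvd m - m'"
    and range_s: "range s = {..<n}"
    and adj_iff: "adj n c r i j \<longleftrightarrow> (\<exists>m. i = s m \<and> j = s (m + 1) \<or> j = s m \<and> i = s (m + 1))"
begin

lemma s_less [simp]: "s m < n"
  using range_s by auto

lemma s_add_period [simp]: "s (m + int n) = s m"
  by (simp add: s_eq_iff)

lemma obtain_index:
  assumes "i < n"
  obtains m where "i = s m"
  using assms range_s by (metis lessThan_iff rangeE)

lemma obtain_small_index:
  assumes "i < n"
  obtains m where "m \<in> {0..<int n}" "i = s m"
proof -
  obtain m where "i = s m" using assms by (rule obtain_index)
  then have "i = s (m mod int n)"
    by (simp add: s_eq_iff minus_mod_eq_mult_div)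
  moreover have "m mod int n \<in> {0..<int n}"
    using three_le_n by simp
  ultimately show ?thesis using that by blast
qed

lemma inj_on_s: "inj_on s {0..<int n}"
proof (rule inj_onI)
  fix x y assume "x \<in> {0..<int n}" "y \<in> {0..<int n}" "s x = s y"
  then show "x = y"
    by (metis s_eq_iff atLeastLessThan_iff mod_eq_dvd_iff mod_pos_pos_trivial)
qed

lemma s_shift_cong: "s m = s m' \<Longrightarrow> s (m + d) = s (m' + d)"
  by (simp add: s_eq_iff)

lemma not_period_dvd:
  assumes "0 < d" "d < 3"
  shows "\<not> int n dvd d"
  using assms three_le_n zdvd_imp_le[of "int n" d] by auto

lemma s_succ_neq: "s (m + 1) \<noteq> s m" "s (m + 1) \<noteq> s (m - 1)"
  using not_period_dvd[of 1] not_period_dvd[of 2] by (simp_all add: s_eq_iff)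

lemma adj_s_iff: "adj n c r (s m) j \<longleftrightarrow> j = s (m + 1) \<or> j = s (m - 1)"
proof
  assume "adj n c r (s m) j"
  then obtain m' where "s m = s m' \<and> j = s (m' + 1) \<or> j = s m' \<and> s m = s (m' + 1)"
    unfolding adj_iff by blast
  then show "j = s (m + 1) \<or> j = s (m - 1)"
    using s_shift_cong[of m m' 1] s_shift_cong[of m "m' + 1" "-1"] by auto
next
  assume "j = s (m + 1) \<or> j = s (m - 1)"
  then show "adj n c r (s m) j"
  proof
    assume "j = s (m - 1)"
    then show ?thesis
      unfolding adj_iff by (intro exI[of _ "m - 1"]) simp
  qed (use adj_iff in blast)
qed

end

text \<open>
  \<open>A m\<close> is, modulo 1, the time at which the robots of \<open>s m\<close> and \<open>s (m + 1)\<close> reach their common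
  link.  As \<open>A\<close> increases by less than 1 per step, a point moving along one of the rings, in the
  direction of increasing \<open>m\<close>, is on \<open>s m\<close> during \<open>{A (m - 1) + k..<A m + k}\<close> for a fixed integer
  \<open>k\<close>, and \<open>N\<close> is the length of this ring in units of \<open>2 * pi\<close>.
\<close>

locale scs_cycle = cycle_graph n c r s
  for n :: nat and c :: "nat \<Rightarrow> complex" and r :: real and s :: "int \<Rightarrow> nat" +
  fixes f :: "nat \<Rightarrow> real" and g :: "nat \<Rightarrow> int" and A :: "int \<Rightarrow> real" and N :: int
  assumes g_cases: "i < n \<Longrightarrow> g i = 1 \<or> g i = -1"
    and g_alternates: "g (s (m + 1)) = - g (s m)"
    and lk_succ: "lk c (s m) (s (m + 1)) = pos f g (s m) (A m)"
    and lk_pred: "lk c (s m) (s (m - 1)) = pos f g (s m) (A (m - 1))"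
    and A_less: "A (m - 1) < A m"
    and A_upper: "A m < A (m - 1) + 1"
    and A_period: "A (m + int n) = A m + of_int N"
begin

lemma pos_eq_lk_succ_iff: "pos f g (s m) t = lk c (s m) (s (m + 1)) \<longleftrightarrow> t - A m \<in> \<int>"
  unfolding lk_succ by (intro pos_eq_iff g_cases s_less)

lemma pos_eq_lk_pred_iff: "pos f g (s m) t = lk c (s m) (s (m - 1)) \<longleftrightarrow> t - A (m - 1) \<in> \<int>"
  unfolding lk_pred by (intro pos_eq_iff g_cases s_less)

text \<open>Enumerating the cycle backwards exchanges the two rings.\<close>

lemma mirror: "scs_cycle n c r (\<lambda>m. s (- m)) f g (\<lambda>m. A (- m - 1) + (of_int m + 1)) (int n - N)"
proof (unfold_locales, goal_cases)
  case (2 m m')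
  have "- m - - m' = - (m - m')" by simp
  then show ?case
    by (simp only: s_eq_iff dvd_minus_iff)
next
  case 3
  have "range (\<lambda>m. s (- m)) = s ` range uminus"
    by (simp only: image_image)
  also have "range uminus = (UNIV :: int set)"
    by (rule surjI[of _ uminus]) simp
  finally show ?case using range_s by simp
next
  case (4 i j)
  have "adj n c r i j \<longleftrightarrow> adj n c r j i"
    unfolding adj_iff by blast
  also have "\<dots> \<longleftrightarrow> (\<exists>m. j = s (- m - 1) \<and> i = s (- m) \<or> i = s (- m - 1) \<and> j = s (- m))"
    unfolding adj_iff
  proof (safe, goal_cases)
    case (1 m) then show ?case by (intro exI[of _ "- m - 1"]) (simp add: add.commute)
  next
    case (2 m) then show ?case by (intro exI[of _ "- m - 1"]) (simp add: add.commute)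
  next
    case (3 m) then show ?case by (intro exI[of _ "- m - 1"]) (simp add: add.commute)
  next
    case (4 m) then show ?case by (intro exI[of _ "- m - 1"]) (simp add: add.commute)
  qed
  finally show ?case by (auto simp: algebra_simps)
next
  case (6 m)
  then show ?case using g_alternates[of "- m - 1"] by simp
next
  case (7 m)
  have "pos f g (s (- m)) (A (- m - 1)) = pos f g (s (- m)) (A (- m - 1) + (of_int m + 1))"
    using g_cases[OF s_less[of "- m"]] by (subst pos_eq_iff) simp_all
  then show ?case using lk_pred[of "- m"] by simp
next
  case (8 m)
  have "pos f g (s (- m)) (A (- m)) = pos f g (s (- m)) (A (- m) + of_int m)"
    using g_cases[OF s_less[of "- m"]] by (subst pos_eq_iff) simp_all
  then show ?case using lk_succ[of "- m"] by simp
next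
  \<comment> \<open>The summand \<open>of_int m + 1\<close> leaves positions unchanged and turns a
    decrease by less than 1 into an increase by less than 1. So the two bounds on the increments of
    \<open>A\<close> exchange their roles.\<close>
  case (9 m)
  then show ?case using A_upper[of "- m"] by simp
next
  case (10 m)
  then show ?case using A_less[of "- m"] by simp
next
  case (11 m)
  then show ?case using A_period[of "- m - int n - 1"] by simp
qed (use three_le_n g_cases in auto)

section \<open>The lifted crossing times and the index of a moving point\<close>

lemma strict_mono_A: "strict_mono A"
proof (rule strict_monoI)
  fix x y :: int assume "x < y"
  then show "A x < A y"
  proof (induction y rule: int_gr_induct)
    case base
    then show ?case using A_less[of "x + 1"] by simp
  next
    case (step y)
    then show ?case using A_less[of "y + 1"] by simp
  qed
qed

lemma N_pos: "0 < N"
  using strict_monoD[OF strict_mono_A, of 0 "int n"] A_period[of 0] three_le_n by simp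

lemma A_add_mult_period: "A (m + j * int n) = A m + of_int (j * N)"
proof (induction j rule: int_induct[of _ 0])
  case (step1 j)
  then show ?case
    using A_period[of "m + j * int n"] by (simp add: algebra_simps)
next
  case (step2 j)
  then show ?case
    using A_period[of "m + (j - 1) * int n"] by (simp add: algebra_simps)
qed simp

text \<open>Both links of the circle shift by the same integer, so a change of the representing
  index is absorbed by the label \<open>k\<close>.\<close>

lemma A_cong:
  assumes "s m = s m'"
  shows "\<exists>j::int. A m = A m' + of_int j \<and> A (m - 1) = A (m' - 1) + of_int j"
proof -
  obtain l where "m - m' = int n * l"
    using assms by (auto simp: s_eq_iff)
  then have "m = m' + l * int n" "m - 1 = (m' - 1) + l * int n"
    by (simp_all add: algebra_simps)
  then show ?thesis
    using A_add_mult_period by metis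
qed

lemma A_unbounded_above: "\<exists>m\<ge>m0. x < A m"
proof -
  obtain j :: nat where "x - A m0 < of_nat j"
    using reals_Archimedean2 by blast
  also have "real j * 1 \<le> real j * of_int N"
    using N_pos by (intro mult_left_mono) simp_all
  finally show ?thesis
    using A_add_mult_period[of m0 "int j"] by (intro exI[of _ "m0 + int j * int n"]) auto
qed

lemma A_unbounded_below: "\<exists>m\<le>m0. A m < x"
proof -
  obtain j :: nat where "A m0 - x < of_nat j"
    using reals_Archimedean2 by blast
  also have "real j * 1 \<le> real j * of_int N"
    using N_pos by (intro mult_left_mono) simp_all
  finally show ?thesis
    using A_add_mult_period[of m0 "- int j"] by (intro exI[of _ "m0 - int j * int n"]) auto
qed

text \<open>A step inverse of \<open>A\<close>: the index reached at time \<open>x\<close> by the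
  token with label 0. The token with label \<open>k\<close> is at
  \<open>idx (t - k)\<close>.\<close>

definition idx :: "real \<Rightarrow> int" where
  "idx x = (SOME m. A (m - 1) \<le> x \<and> x < A m)"

lemma index_between_unique:
  assumes "A (m - 1) \<le> x" "x < A m" "A (m' - 1) \<le> x" "x < A m'"
  shows "m = m'"
proof -
  have "A (m - 1) < A m'" "A (m' - 1) < A m"
    using assms by linarith+
  then show ?thesis
    by (simp add: strict_mono_less[OF strict_mono_A])
qed

lemma ex_index: "\<exists>m. A (m - 1) \<le> x \<and> x < A m"
proof -
  obtain l where "A l < x" using A_unbounded_below by blast
  moreover obtain h where "l \<le> h" "x < A h" using A_unbounded_above by blast
  ultimately show ?thesis
    using int_crossing[of "\<lambda>m. x < A m" l h] by (auto simp: not_less)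
qed

text \<open>Closed on the other side than \<open>idx\<close>: this is the index just before
  \<open>x\<close>, as left limits require.\<close>

lemma ex_left_index: "\<exists>m. A (m - 1) < x \<and> x \<le> A m"
proof -
  obtain l where "A l < x" using A_unbounded_below by blast
  moreover obtain h where "l \<le> h" "x < A h" using A_unbounded_above by blast
  ultimately show ?thesis
    using int_crossing[of "\<lambda>m. x \<le> A m" l h] by (auto simp: not_le)
qed

lemma idx_bounds: "A (idx x - 1) \<le> x" "x < A (idx x)"
  using someI_ex[OF ex_index[of x]] by (simp_all add: idx_def)

lemma idx_eqI: "A (m - 1) \<le> x \<Longrightarrow> x < A m \<Longrightarrow> idx x = m"
  using idx_bounds index_between_unique by blast

lemma idx_right_constant:
  "\<exists>e>0. \<forall>u. t \<le> u \<and> u < t + e \<longrightarrow> idx (u - k) = idx (t - k)"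
proof (intro exI[of _ "A (idx (t - k)) + k - t"] conjI allI impI)
  show "0 < A (idx (t - k)) + k - t"
    using idx_bounds(2)[of "t - k"] by simp
  show "idx (u - k) = idx (t - k)" if "t \<le> u \<and> u < t + (A (idx (t - k)) + k - t)" for u
    using that idx_bounds(1)[of "t - k"] by (intro idx_eqI) auto
qed

lemma eventually_idx_eq_left:
  assumes "A (m - 1) + k < t" "t \<le> A m + k"
  shows "\<forall>\<^sub>F u in at_left t. idx (u - k) = m"
  using assms by (intro eventually_at_leftI[of "A (m - 1) + k"] idx_eqI) auto

lemma idx_after_left:
  assumes "A (m - 1) + k < t" "t \<le> A m + k"
  shows "idx (t - k) = (if t = A m + k then m + 1 else m)"
  using assms A_less[of "m + 1"] by (auto intro!: idx_eqI)

section \<open>A single switching event\<close>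

text \<open>The window is shorter than one turn. It is open at the entry link, which is therefore
  not reached again, and contains the exit link only as its right end.\<close>

lemma at_link_iff:
  assumes "A (m - 1) + of_int k < t" "t \<le> A m + of_int k"
  shows "adj n c r (s m) j \<and> pos f g (s m) t = lk c (s m) j \<longleftrightarrow> j = s (m + 1) \<and> t = A m + of_int k"
proof -
  have succ: "t - A m \<in> \<int> \<longleftrightarrow> t = A m + of_int k"
  proof
    assume "t - A m \<in> \<int>"
    then obtain l where l: "t - A m = of_int l" by (auto elim: Ints_cases)
    have "of_int (k - 1) < (of_int l :: real)" "(of_int l :: real) \<le> of_int k"
      using l assms A_upper[of m] by simp_all
    then have "l = k" by linarith
    with l show "t = A m + of_int k" by simp
  qed simp
  have "t - A (m - 1) \<notin> \<int>"
  proof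
    assume "t - A (m - 1) \<in> \<int>"
    then obtain l where l: "t - A (m - 1) = of_int l" by (auto elim: Ints_cases)
    have "of_int k < (of_int l :: real)" "(of_int l :: real) < of_int (k + 1)"
      using l assms A_upper[of m] by simp_all
    then have "k < l" "l < k + 1"
      by (simp_all only: of_int_less_iff)
    then show False by simp
  qed
  then show ?thesis
    using succ pos_eq_lk_succ_iff[of m t] pos_eq_lk_pred_iff[of m t] s_succ_neq[of m]
    by (auto simp: adj_s_iff)
qed

text \<open>At most one link is reached at a time, so the choice by \<open>SOME\<close> in
  \<open>step\<close> is determined.\<close>

lemma step_token:
  fixes lv x t
  defines "y \<equiv> after_leave lv t x"
  assumes "y u = Some (s m)" "A (m - 1) + of_int k < t" "t \<le> A m + of_int k"
  shows "step n c r f g lv t x u =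
    Some (s (if t = A m + of_int k \<and> \<not> occupied y (s (m + 1)) then m + 1 else m))"
proof -
  have "(adj n c r (s m) j \<and> pos f g (s m) t = lk c (s m) j \<and> \<not> occupied y j) \<longleftrightarrow>
      j = s (m + 1) \<and> t = A m + of_int k \<and> \<not> occupied y (s (m + 1))" for j
    using at_link_iff[OF assms(3,4), of j] by auto
  note * = this
  show ?thesis
    unfolding step_def Let_def y_def[symmetric] assms(2) option.case *
    by (cases "t = A m + of_int k \<and> \<not> occupied y (s (m + 1))") (simp_all only:, simp_all)
qed

text \<open>
  The robot occupying a forward circle lies in the ring that runs in the direction of increasing
  indices; \<open>forward_before\<close> refers to the instant just before \<open>t\<close>.
\<close>

definition forward :: "real \<Rightarrow> nat \<Rightarrow> bool" where
  "forward t i \<longleftrightarrow> (\<exists>m k::int. i = s m \<and> A (m - 1) + of_int k \<le> t \<and> t < A m + of_int k)"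

lemma forward_less: "forward t i \<Longrightarrow> i < n"
  by (auto simp: forward_def)

definition forward_before :: "real \<Rightarrow> nat \<Rightarrow> bool" where
  "forward_before t i \<longleftrightarrow>
    (\<exists>m k::int. i = s m \<and> A (m - 1) + of_int k < t \<and> t \<le> A m + of_int k)"

section \<open>Counting the circles of a ring\<close>

text \<open>The admissible \<open>k\<close> are the integers above \<open>t - A m\<close> and at
  most \<open>t - A (m - 1)\<close>, an interval of length below 1. Written with floors, their
  number telescopes over a lap.\<close>

lemma forward_s_iff: "forward t (s m) \<longleftrightarrow> \<lfloor>t - A (m - 1)\<rfloor> - \<lfloor>t - A m\<rfloor> = 1"
proof -
  have "forward t (s m) \<longleftrightarrow> (\<exists>k::int. A (m - 1) + of_int k \<le> t \<and> t < A m + of_int k)"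
  proof
    assume "forward t (s m)"
    then obtain m' k where *: "s m = s m'" "A (m' - 1) + of_int k \<le> t" "t < A m' + of_int k"
      unfolding forward_def by blast
    obtain j :: int where "A m = A m' + of_int j" "A (m - 1) = A (m' - 1) + of_int j"
      using A_cong[OF *(1)] by blast
    with * show "\<exists>k::int. A (m - 1) + of_int k \<le> t \<and> t < A m + of_int k"
      by (intro exI[of _ "k - j"]) simp
  qed (auto simp: forward_def)
  also have "\<dots> \<longleftrightarrow> (\<exists>k. k \<le> \<lfloor>t - A (m - 1)\<rfloor> \<and> \<lfloor>t - A m\<rfloor> < k)"
    by (simp add: le_floor_iff floor_less_iff algebra_simps)
  also have "\<dots> \<longleftrightarrow> \<lfloor>t - A (m - 1)\<rfloor> - \<lfloor>t - A m\<rfloor> = 1"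
  proof -
    have "\<lfloor>t - A (m - 1)\<rfloor> \<le> \<lfloor>t - A m\<rfloor> + 1"
      using A_upper[of m] by linarith
    then show ?thesis by (auto intro: exI[of _ "\<lfloor>t - A m\<rfloor> + 1"])
  qed
  finally show ?thesis .
qed

lemma forward_before_s_iff: "forward_before t (s m) \<longleftrightarrow> \<lceil>t - A (m - 1)\<rceil> - \<lceil>t - A m\<rceil> = 1"
proof -
  have "forward_before t (s m) \<longleftrightarrow> (\<exists>k::int. A (m - 1) + of_int k < t \<and> t \<le> A m + of_int k)"
  proof
    assume "forward_before t (s m)"
    then obtain m' k where *: "s m = s m'" "A (m' - 1) + of_int k < t" "t \<le> A m' + of_int k"
      unfolding forward_before_def by blast
    obtain j :: int where "A m = A m' + of_int j" "A (m - 1) = A (m' - 1) + of_int j"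
      using A_cong[OF *(1)] by blast
    with * show "\<exists>k::int. A (m - 1) + of_int k < t \<and> t \<le> A m + of_int k"
      by (intro exI[of _ "k - j"]) simp
  qed (auto simp: forward_before_def)
  also have "\<dots> \<longleftrightarrow> (\<exists>k. k < \<lceil>t - A (m - 1)\<rceil> \<and> \<lceil>t - A m\<rceil> \<le> k)"
    by (simp add: less_ceiling_iff ceiling_le_iff algebra_simps)
  also have "\<dots> \<longleftrightarrow> \<lceil>t - A (m - 1)\<rceil> - \<lceil>t - A m\<rceil> = 1"
  proof -
    have "\<lceil>t - A (m - 1)\<rceil> \<le> \<lceil>t - A m\<rceil> + 1"
      using A_upper[of m] by linarith
    then show ?thesis by (auto intro: exI[of _ "\<lceil>t - A m\<rceil>"])
  qed
  finally show ?thesis .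
qed

lemma card_image_index:
  assumes "\<And>i. P i \<Longrightarrow> i < n" "\<And>m. P (s m) \<longleftrightarrow> Q m"
  shows "card {i. P i} = card {m \<in> {0..<int n}. Q m}"
proof -
  have "{i. P i} = s ` {m \<in> {0..<int n}. Q m}"
  proof (intro set_eqI iffI)
    fix i assume "i \<in> {i. P i}"
    with assms show "i \<in> s ` {m \<in> {0..<int n}. Q m}"
      by (metis (mono_tags, lifting) obtain_small_index imageI mem_Collect_eq)
  qed (use assms(2) in auto)
  moreover have "inj_on s {m \<in> {0..<int n}. Q m}"
    by (rule inj_on_subset[OF inj_on_s]) auto
  ultimately show ?thesis
    by (simp add: card_image)
qed

lemma A_last: "A (int n - 1) = A (- 1) + of_int N"
  using A_period[of "-1"] by simp

text \<open>Holds at every time, also when robots are at links, because the intervals in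
  \<open>forward\<close> are half-open.\<close>

lemma card_forward: "int (card {i. forward t i}) = N"
proof -
  have "card {i. forward t i} = card {m \<in> {0..<int n}. \<lfloor>t - A (m - 1)\<rfloor> - \<lfloor>t - A m\<rfloor> = 1}"
    by (intro card_image_index forward_s_iff) (auto simp: forward_def)
  also have "int \<dots> = N"
  proof (rule telescoping_card)
    show "\<lfloor>t - A (m - 1)\<rfloor> - \<lfloor>t - A m\<rfloor> = 0 \<or> \<lfloor>t - A (m - 1)\<rfloor> - \<lfloor>t - A m\<rfloor> = 1" for m
      using A_less[of m] A_upper[of m] by linarith
    have "t - A (int n - 1) = t - A (- 1) - of_int N"
      by (simp add: A_last)
    then show "\<lfloor>t - A (int n - 1)\<rfloor> = \<lfloor>t - A (- 1)\<rfloor> - N"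
      by (simp only: floor_diff_of_int)
  qed
  finally show ?thesis .
qed

lemma card_forward_before: "int (card {i. forward_before t i}) = N"
proof -
  have "card {i. forward_before t i} =
      card {m \<in> {0..<int n}. \<lceil>t - A (m - 1)\<rceil> - \<lceil>t - A m\<rceil> = 1}"
    by (intro card_image_index forward_before_s_iff) (auto simp: forward_before_def)
  also have "int \<dots> = N"
  proof (rule telescoping_card)
    show "\<lceil>t - A (m - 1)\<rceil> - \<lceil>t - A m\<rceil> = 0 \<or> \<lceil>t - A (m - 1)\<rceil> - \<lceil>t - A m\<rceil> = 1" for m
      using A_less[of m] A_upper[of m] by linarith
    have "t - A (int n - 1) = t - A (- 1) - of_int N"
      by (simp add: A_last)
    then show "\<lceil>t - A (int n - 1)\<rceil> = \<lceil>t - A (- 1)\<rceil> - N"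
      by (simp only: ceiling_diff_of_int)
  qed
  finally show ?thesis .
qed

section \<open>Invariants of runs\<close>

definition state_ok :: "(nat \<Rightarrow> real option) \<Rightarrow> real \<Rightarrow> state \<Rightarrow> bool" where
  "state_ok lv t x \<longleftrightarrow>
     (\<forall>u v i. x u = Some i \<and> x v = Some i \<longrightarrow> u = v) \<and>
     (\<forall>u i. x u = Some i \<longrightarrow> i < n) \<and>
     (\<forall>u<n. \<not> (\<exists>\<tau>. lv u = Some \<tau> \<and> \<tau> \<le> t) \<longrightarrow> x u \<noteq> None)"

lemma state_ok_mono: "state_ok lv t x \<Longrightarrow> t \<le> t' \<Longrightarrow> state_ok lv t' x"
  unfolding state_ok_def by (meson order_trans)

text \<open>Prevents two robots from entering the same empty circle at once. Two different
  neighbours could do so only if both links of \<open>j\<close> were reached at the same instant,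
  but these times differ by a non-integer.\<close>

lemma link_unique:
  assumes "adj n c r i j" "pos f g i t = lk c i j" "adj n c r i' j" "pos f g i' t = lk c i' j"
  shows "i = i'"
proof -
  have "\<exists>m. j = s m \<and> (i = s (m + 1) \<and> t - A m \<in> \<int> \<or> i = s (m - 1) \<and> t - A (m - 1) \<in> \<int>)"
    if "adj n c r i j" "pos f g i t = lk c i j" for i
  proof -
    obtain m where "i = s m \<and> j = s (m + 1) \<or> j = s m \<and> i = s (m + 1)"
      using \<open>adj n c r i j\<close> unfolding adj_iff by blast
    then show ?thesis
    proof
      assume "i = s m \<and> j = s (m + 1)"
      then show ?thesis
        using that(2) pos_eq_lk_succ_iff[of m t] by (intro exI[of _ "m + 1"]) simp
    next
      assume "j = s m \<and> i = s (m + 1)"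
      then show ?thesis
        using that(2) pos_eq_lk_pred_iff[of "m + 1" t] by (intro exI[of _ m]) simp
    qed
  qed
  from this[OF assms(1,2)] this[OF assms(3,4)] obtain m m' where
    m: "j = s m" "i = s (m + 1) \<and> t - A m \<in> \<int> \<or> i = s (m - 1) \<and> t - A (m - 1) \<in> \<int>" and
    m': "j = s m'" "i' = s (m' + 1) \<and> t - A m' \<in> \<int> \<or> i' = s (m' - 1) \<and> t - A (m' - 1) \<in> \<int>"
    by blast
  have eq: "s m = s m'" using m(1) m'(1) by simp
  obtain l :: int where l: "A m = A m' + of_int l" "A (m - 1) = A (m' - 1) + of_int l"
    using A_cong[OF eq] by blast
  have "\<not> (t - A m \<in> \<int> \<and> t - A (m - 1) \<in> \<int>)"
  proof
    assume "t - A m \<in> \<int> \<and> t - A (m - 1) \<in> \<int>"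
    then have "(t - A (m - 1)) - (t - A m) \<in> \<int>"
      using Ints_diff by blast
    then obtain d :: int where d: "A m - A (m - 1) = of_int d"
      by (auto elim: Ints_cases)
    then have "0 < d" "d < 1"
      using A_less[of m] A_upper[of m] by linarith+
    then show False by simp
  qed
  moreover have "t - A m' \<in> \<int> \<longleftrightarrow> t - A m \<in> \<int>"
    using add_in_Ints_iff_right[of "of_int l" "t - A m"] l(1) by (simp add: algebra_simps)
  moreover have "t - A (m' - 1) \<in> \<int> \<longleftrightarrow> t - A (m - 1) \<in> \<int>"
    using add_in_Ints_iff_right[of "of_int l" "t - A (m - 1)"] l(2) by (simp add: algebra_simps)
  moreover have "s (m + 1) = s (m' + 1)" "s (m - 1) = s (m' - 1)"
    using s_shift_cong[OF eq, of 1] s_shift_cong[OF eq, of "-1"] by simp_all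
  ultimately show ?thesis
    using m(2) m'(2) by auto
qed

lemma step_cases:
  assumes "step n c r f g lv t x u = Some j"
  obtains "after_leave lv t x u = Some j"
  | i where "after_leave lv t x u = Some i" "adj n c r i j" "pos f g i t = lk c i j"
      "\<not> occupied (after_leave lv t x) j"
proof -
  obtain i where i: "after_leave lv t x u = Some i"
    using assms unfolding step_def Let_def by (cases "after_leave lv t x u") auto
  let ?Q = "\<lambda>j. adj n c r i j \<and> pos f g i t = lk c i j \<and> \<not> occupied (after_leave lv t x) j"
  show ?thesis
  proof (cases "\<exists>j. ?Q j")
    case True
    then have "j = (SOME j. ?Q j)"
      using assms i unfolding step_def Let_def by simp
    then have "?Q j"
      using someI_ex[OF True] by simp
    with i that(2) show ?thesis by blast
  next
    case False
    then have "step n c r f g lv t x u = Some i"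
      unfolding step_def Let_def by (simp only: i option.case if_False)
    with assms i that(1) show ?thesis by simp
  qed
qed

lemma step_eq_None_iff: "step n c r f g lv t x u = None \<longleftrightarrow> after_leave lv t x u = None"
  by (simp add: step_def Let_def split: option.split)

lemma state_ok_step:
  assumes "state_ok lv t x"
  shows "state_ok lv t (step n c r f g lv t x)"
proof -
  define y where "y = after_leave lv t x"
  have y_inj: "u = v" if "y u = Some i" "y v = Some i" for u v i
    using that assms unfolding y_def after_leave_eq_Some_iff state_ok_def by blast
  have "u = v" if "step n c r f g lv t x u = Some j" "step n c r f g lv t x v = Some j" for u v j
    using that(1)
  proof (cases rule: step_cases)
    case 1
    note u = this
    show ?thesis using that(2)
    proof (cases rule: step_cases)
      case 1
      with u y_inj show ?thesis by (simp add: y_def)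
    next
      case (2 i)
      with u show ?thesis by (auto simp: occupied_def)
    qed
  next
    case (2 i)
    note u = this
    show ?thesis using that(2)
    proof (cases rule: step_cases)
      case 1
      with u show ?thesis by (auto simp: occupied_def)
    next
      case (2 i')
      with u have "i = i'" by (intro link_unique)
      with u 2 y_inj show ?thesis by (simp add: y_def)
    qed
  qed
  moreover have "j < n" if "step n c r f g lv t x u = Some j" for u j
    using that
  proof (cases rule: step_cases)
    case 1
    with assms show ?thesis by (auto simp: after_leave_eq_Some_iff state_ok_def)
  next
    case (2 i)
    then show ?thesis by (auto simp: adj_def)
  qed
  moreover have "step n c r f g lv t x u \<noteq> None"
    if "u < n" "\<not> (\<exists>\<tau>. lv u = Some \<tau> \<and> \<tau> \<le> t)" for u
    using that assms unfolding step_eq_None_iff state_ok_def after_leave_def by simp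
  ultimately show ?thesis
    unfolding state_ok_def by blast
qed

lemma run_left_state:
  assumes "is_run n c r f g lv loc" "0 \<le> t"
  obtains x where "left_state n loc t x" "loc t = step n c r f g lv t x"
  using assms unfolding is_run_def by blast

lemma run_right_constant:
  assumes "is_run n c r f g lv loc" "0 \<le> t"
  shows "\<exists>e>0. \<forall>u. t \<le> u \<and> u < t + e \<longrightarrow> loc u = loc t"
  using assms unfolding is_run_def by blast

lemma left_state_sample:
  assumes "left_state n loc t x" "0 < t" "T < t"
  obtains u where "T < u" "u < t" "loc u = x"
proof -
  have "\<forall>\<^sub>F u in at_left t. loc u = x" "\<forall>\<^sub>F u in at_left t. u \<in> {T<..<t}"
    using assms by (auto intro: left_state_eventually eventually_at_leftI)
  then have "\<forall>\<^sub>F u in at_left t. loc u = x \<and> u \<in> {T<..<t}"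
    by (rule eventually_conj)
  then obtain u where "loc u = x \<and> u \<in> {T<..<t}"
    using eventually_happens[of _ "at_left t"] by force
  then show ?thesis using that[of u] by simp
qed

lemma run_state_ok:
  assumes "is_run n c r f g lv loc" "0 \<le> t"
  shows "state_ok lv t (loc t)"
  using assms(2)
proof (induction rule: real_interval_induct)
  case base
  obtain x where "left_state n loc 0 x" "loc 0 = step n c r f g lv 0 x"
    using run_left_state[OF assms(1), of 0] by auto
  moreover from this have "x = init_state n"
    by (simp add: left_state_def)
  moreover have "state_ok lv 0 (init_state n)"
    by (auto simp: state_ok_def init_state_def split: if_splits)
  ultimately show ?case
    using state_ok_step by simp
next
  case (right t)
  then obtain e where "e > 0" "\<forall>u. t \<le> u \<and> u < t + e \<longrightarrow> loc u = loc t"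
    using run_right_constant[OF assms(1)] by blast
  with right show ?case
    using state_ok_mono by metis
next
  case (left t)
  obtain x where x: "left_state n loc t x" "loc t = step n c r f g lv t x"
    using run_left_state[OF assms(1), of t] left(1) by auto
  obtain u where "0 < u" "u < t" "loc u = x"
    using left_state_sample[OF x(1) left(1) left(1)] by blast
  with left(2)[of u] have "state_ok lv t x"
    using state_ok_mono[of lv u x t] by simp
  with x(2) show ?case
    using state_ok_step by simp
qed

lemma run_not_left:
  assumes "is_run n c r f g lv loc" "0 \<le> t" "loc t u = Some i" "lv u = Some \<tau>"
  shows "t < \<tau>"
proof -
  obtain x where "loc t = step n c r f g lv t x"
    using run_left_state[OF assms(1,2)] by blast
  with assms(3) have "after_leave lv t x u \<noteq> None"
    using step_eq_None_iff[of lv t x u] by simp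
  then show ?thesis
    using assms(4) by (auto simp: after_leave_def not_less split: if_splits)
qed

section \<open>Few departures: two robots of different rings meet\<close>

text \<open>A starving robot finds the circle beyond each link empty and always switches, so its
  label \<open>k\<close> stays the same for ever.\<close>

lemma starving_robot_follows_ring:
  assumes run: "is_run n c r f g lv loc"
    and starve: "starvation_from n c r f g lv loc T"
    and T: "0 \<le> T" and stays: "lv u0 = None"
    and start: "loc T u0 = Some (s m)" "A (m - 1) + of_int k \<le> T" "T < A m + of_int k"
    and t: "T \<le> t"
  shows "loc t u0 = Some (s (idx (t - of_int k)))"
  using t
proof (induction rule: real_interval_induct)
  case base
  then show ?case
    using start idx_eqI[of m "T - of_int k"] by simp
next
  case (right t)
  obtain e where e: "e > 0" "\<forall>u. t \<le> u \<and> u < t + e \<longrightarrow> loc u = loc t"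
    using run_right_constant[OF run, of t] right T by auto
  obtain e' where e': "e' > 0"
    "\<forall>u. t \<le> u \<and> u < t + e' \<longrightarrow> idx (u - of_int k) = idx (t - of_int k)"
    using idx_right_constant by blast
  show ?case
  proof (intro exI[of _ "min e e'"] conjI allI impI)
    fix u assume "t \<le> u \<and> u < t + min e e'"
    then have "t \<le> u" "u < t + e" "u < t + e'"
      by linarith+
    then have "loc u = loc t" "idx (u - of_int k) = idx (t - of_int k)"
      using e(2) e'(2) by blast+
    with right(2) show "loc u u0 = Some (s (idx (u - of_int k)))"
      by simp
  qed (use e(1) e'(1) in simp)
next
  case (left t)
  obtain x where x: "left_state n loc t x" "loc t = step n c r f g lv t x"
    using run_left_state[OF run, of t] left(1) T by auto
  obtain m where m: "A (m - 1) + of_int k < t" "t \<le> A m + of_int k"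
    using ex_left_index[of "t - of_int k"] by (auto simp: algebra_simps)
  obtain b where b: "b < t" "\<forall>y>b. y < t \<longrightarrow> idx (y - of_int k) = m"
    using eventually_idx_eq_left[OF m] by (auto simp: eventually_at_left[of "t - 1"])
  have "0 < t" "max T b < t"
    using T b(1) left(1) by simp_all
  then obtain \<tau> where "max T b < \<tau>" "\<tau> < t" "loc \<tau> = x"
    by (rule left_state_sample[OF x(1)])
  moreover from this have "idx (\<tau> - of_int k) = m"
    using b(2) by simp
  ultimately have "x u0 = Some (s m)"
    using left(2)[of \<tau>] by simp
  then have y: "after_leave lv t x u0 = Some (s m)"
    using stays by (simp add: after_leave_def)
  have "\<not> occupied (after_leave lv t x) (s (m + 1))" if "t = A m + of_int k"
    using starve x(1) y stays left(1) at_link_iff[OF m, of "s (m + 1)"] that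
    unfolding starvation_from_def by (meson less_imp_le)
  then show ?case
    using x(2) step_token[OF y m] idx_after_left[OF m] by auto
qed

text \<open>Pigeonhole: the robots that never leave sit on different circles, and they outnumber the
  circles outside \<open>F\<close>.\<close>

lemma occupied_circle_in:
  assumes run: "is_run n c r f g lv loc" "0 \<le> t"
    and lv: "dom lv \<subseteq> {..<n}" and F: "F \<subseteq> {..<n}" "card (dom lv) < card F"
  shows "\<exists>i\<in>F. \<exists>u. loc t u = Some i"
proof (rule ccontr)
  assume none: "\<not> ?thesis"
  have ok: "state_ok lv t (loc t)"
    by (rule run_state_ok[OF run])
  define V where "V = {..<n} - dom lv"
  have some: "\<exists>i<n. loc t u = Some i" if "u \<in> V" for u
  proof -
    have "loc t u \<noteq> None"
      using ok that unfolding state_ok_def V_def by auto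
    then show ?thesis
      using ok unfolding state_ok_def by blast
  qed
  have "inj_on (\<lambda>u. the (loc t u)) V"
  proof (rule inj_onI)
    fix u v assume "u \<in> V" "v \<in> V" "the (loc t u) = the (loc t v)"
    then have "\<exists>i. loc t u = Some i \<and> loc t v = Some i"
      using some by fastforce
    then show "u = v"
      using ok unfolding state_ok_def by blast
  qed
  moreover have "card V = n - card (dom lv)"
    using lv unfolding V_def by (subst card_Diff_subset) (auto intro: finite_subset)
  ultimately have "card ((\<lambda>u. the (loc t u)) ` V) = n - card (dom lv)"
    by (simp add: card_image)
  moreover have "F \<inter> (\<lambda>u. the (loc t u)) ` V = {}"
    using none some by fastforce
  moreover have "(\<lambda>u. the (loc t u)) ` V \<subseteq> {..<n}"
    using some by fastforce
  ultimately have "card F + (n - card (dom lv)) \<le> n"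
    using F(1) card_Un_disjoint[of F "(\<lambda>u. the (loc t u)) ` V"]
      card_mono[of "{..<n}" "F \<union> (\<lambda>u. the (loc t u)) ` V"]
    by (simp add: finite_subset)
  moreover have "card (dom lv) \<le> n"
    using card_mono[of "{..<n}" "dom lv"] lv by simp
  ultimately show False
    using F(2) by linarith
qed

text \<open>
  While every robot starves, a robot stays on its ring for ever.  As fewer robots left than either
  ring contains, some robot keeps circulating in each ring, and these two meet: the crossing times
  of edge \<open>p\<close> are \<open>A p + k\<close> and \<open>A p - p + k'\<close>, which agree for \<open>p = k' - k\<close>.
\<close>

lemma not_starving_if_few_leave:
  assumes run: "is_run n c r f g lv loc"
    and lv: "dom lv \<subseteq> {..<n}" "int (card (dom lv)) < N" "int (card (dom lv)) < int n - N"
  shows "\<not> falls_into_starvation n c r f g lv loc"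
proof
  assume "falls_into_starvation n c r f g lv loc"
  then obtain T0 where T0: "starvation_from n c r f g lv loc T0"
    unfolding falls_into_starvation_def by blast
  interpret M: scs_cycle n c r "\<lambda>m. s (- m)" f g "\<lambda>m. A (- m - 1) + (of_int m + 1)" "int n - N"
    by (rule mirror)
  have "finite (ran lv)"
    using lv(1) by (intro finite_ran) (auto intro: finite_subset)
  \<comment> \<open>After \<open>T\<close> nobody leaves any more, so each robot present at
    \<open>T\<close> is a surviving, starving one.\<close>
  define T where "T = Max (insert 0 (insert T0 (ran lv)))"
  have T_ge: "z \<le> T" if "z \<in> insert 0 (insert T0 (ran lv))" for z
    unfolding T_def using \<open>finite (ran lv)\<close> that by (intro Max_ge finite.insertI)
  then have T: "0 \<le> T" "T0 \<le> T" and left: "\<And>u \<tau>. lv u = Some \<tau> \<Longrightarrow> \<tau> \<le> T"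
    by (auto intro: ranI)
  have starve: "starvation_from n c r f g lv loc T"
    using T0 T(2) unfolding starvation_from_def by (meson order_trans)
  have stays: "lv u = None" if "loc T u = Some i" for u i
    using run_not_left[OF run T(1) that] left by (cases "lv u") (auto simp: not_le[symmetric])
  have "\<exists>i\<in>{i. forward T i}. \<exists>u. loc T u = Some i"
    using card_forward[of T] lv(2)
    by (intro occupied_circle_in[OF run T(1) lv(1)]) (auto dest: forward_less)
  then obtain u m k where u: "loc T u = Some (s m)"
    "A (m - 1) + of_int k \<le> T" "T < A m + of_int k"
    unfolding forward_def by blast
  have "\<exists>i\<in>{i. M.forward T i}. \<exists>u. loc T u = Some i"
    using M.card_forward[of T] lv(3)
    by (intro occupied_circle_in[OF run T(1) lv(1)]) (auto dest: M.forward_less)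
  then obtain v m' k' where v: "loc T v = Some (s (- m'))"
    "A (- (m' - 1) - 1) + (of_int (m' - 1) + 1) + of_int k' \<le> T"
    "T < A (- m' - 1) + (of_int m' + 1) + of_int k'"
    unfolding M.forward_def by blast
  obtain q where q: "T - of_int k < A q"
    using A_unbounded_above[of 0 "T - of_int k"] by blast
  \<comment> \<open>Counting \<open>j\<close> more laps for \<open>v\<close> raises its label by
    \<open>j * (int n - N)\<close> without changing its position. This moves the meeting edge
    \<open>p\<close> up by at least \<open>j\<close>, far enough for the meeting to lie after
    \<open>T\<close>.\<close>
  define j where "j = max 0 (q + k - k')"
  define l where "l = k' + j * (int n - N)"
  define p where "p = l - k"
  define t where "t = A p + of_int k"
  have "j * 1 \<le> j * (int n - N)"
    using M.N_pos by (intro mult_left_mono) (auto simp: j_def)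
  then have "q \<le> p"
    by (simp add: p_def l_def j_def)
  then have "A q \<le> A p"
    by (simp add: strict_mono_less_eq[OF strict_mono_A])
  then have "T < t"
    using q by (simp add: t_def)
  have vl: "loc T v = Some (s (- (m' - j * int n)))"
    "A (- (m' - j * int n - 1) - 1) + (of_int (m' - j * int n - 1) + 1) + of_int l \<le> T"
    "T < A (- (m' - j * int n) - 1) + (of_int (m' - j * int n) + 1) + of_int l"
  proof -
    have "s (- (m' - j * int n)) = s (- m')"
      by (simp add: s_eq_iff)
    then show "loc T v = Some (s (- (m' - j * int n)))"
      using v(1) by simp
    show "A (- (m' - j * int n - 1) - 1) + (of_int (m' - j * int n - 1) + 1) + of_int l \<le> T"
      using v(2) A_add_mult_period[of "- (m' - 1) - 1" j] by (simp add: l_def algebra_simps)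
    show "T < A (- (m' - j * int n) - 1) + (of_int (m' - j * int n) + 1) + of_int l"
      using v(3) A_add_mult_period[of "- m' - 1" j] by (simp add: l_def algebra_simps)
  qed
  have up: "A (p - 1) + of_int k < t" "t \<le> A p + of_int k"
    using A_less[of p] by (simp_all add: t_def)
  have vp: "A (- ((- p - 1) - 1) - 1) + (of_int ((- p - 1) - 1) + 1) + of_int l < t"
    "t \<le> A (- (- p - 1) - 1) + (of_int (- p - 1) + 1) + of_int l"
    using A_upper[of "p + 1"] by (simp_all add: t_def p_def add.commute)
  obtain x where x: "left_state n loc t x"
    using run_left_state[OF run, of t] T(1) \<open>T < t\<close> by auto
  \<comment> \<open>The configuration of the meeting is read off at an instant \<open>w\<close> just
    before \<open>t\<close>, where the state is already \<open>x\<close> and both robots are on the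
    circles joined by edge \<open>p\<close>.\<close>
  have "\<forall>\<^sub>F w in at_left t. w \<in> {T<..<t}"
    using \<open>T < t\<close> by (intro eventually_at_leftI) auto
  moreover have "\<forall>\<^sub>F w in at_left t. loc w = x"
    using x \<open>T < t\<close> T(1) by (intro left_state_eventually) auto
  ultimately have "\<forall>\<^sub>F w in at_left t. w \<in> {T<..<t} \<and> loc w = x \<and>
      idx (w - of_int k) = p \<and> M.idx (w - of_int l) = - p - 1"
    using eventually_idx_eq_left[OF up] M.eventually_idx_eq_left[OF vp]
    by (intro eventually_conj)
  then obtain w where w: "T < w" "w < t" "loc w = x"
    "idx (w - of_int k) = p" "M.idx (w - of_int l) = - p - 1"
    using eventually_happens[of _ "at_left t"] by force
  have "x u = Some (s p)"
    using starving_robot_follows_ring[OF run starve T(1) stays[OF u(1)] u, of w] w by simp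
  then have xu: "after_leave lv t x u = Some (s p)"
    using stays[OF u(1)] by (simp add: after_leave_def)
  have "x v = Some (s (- (- p - 1)))"
    using M.starving_robot_follows_ring[OF run starve T(1) stays[OF v(1)] vl, of w] w by simp
  then have "after_leave lv t x v = Some (s (p + 1))"
    using stays[OF v(1)] by (simp add: after_leave_def add.commute)
  then have "occupied (after_leave lv t x) (s (p + 1))"
    unfolding occupied_def by blast
  moreover have "adj n c r (s p) (s (p + 1)) \<and> pos f g (s p) t = lk c (s p) (s (p + 1))"
    using at_link_iff[OF up, of "s (p + 1)"] by (simp add: t_def)
  ultimately show False
    using starve x xu stays[OF u(1)] \<open>T < t\<close> unfolding starvation_from_def
    by (meson less_imp_le)
qed

section \<open>A starving run when a whole ring leaves\<close>

text \<open>All robots outside the forward ring leave at time 0, with further ones to make up the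
  number \<open>k\<close>. The survivors are on the same ring and never meet, so the run can be
  written down explicitly by means of \<open>idx\<close>.\<close>

lemma starving_if_ring_leaves:
  assumes "int n - N \<le> int k" "k \<le> n"
  shows "\<exists>lv loc. dom lv \<subseteq> {..<n} \<and> card (dom lv) = k \<and> (\<forall>u \<tau>. lv u = Some \<tau> \<longrightarrow> 0 \<le> \<tau>) \<and>
    is_run n c r f g lv loc \<and> falls_into_starvation n c r f g lv loc"
proof -
  \<comment> \<open>\<open>forward_before\<close> and not \<open>forward\<close>: the initial state
    precedes the switches of time 0.\<close>
  define B where "B = {..<n} - {i. forward_before 0 i}"
  have "{i. forward_before 0 i} \<subseteq> {..<n}"
    by (auto simp: forward_before_def)
  then have "int (card B) = int n - N"
    using card_forward_before[of 0] card_mono[of "{..<n}" "{i. forward_before 0 i}"]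
    unfolding B_def by (subst card_Diff_subset) (auto intro: finite_subset simp: of_nat_diff)
  then have "card B \<le> k"
    using assms(1) by simp
  then obtain W where W: "B \<subseteq> W" "W \<subseteq> {..<n}" "card W = k"
    using exists_subset_between[of B k "{..<n}"] assms(2) unfolding B_def by auto
  define V where "V = {..<n} - W"
  have "finite V" by (simp add: V_def)
  have "\<forall>u\<in>V. \<exists>m l::int. u = s m \<and> A (m - 1) + of_int l < 0 \<and> 0 \<le> A m + of_int l"
    using W(1) unfolding V_def B_def forward_before_def by blast
  then obtain m0 l where start:
    "\<And>u. u \<in> V \<Longrightarrow> u = s (m0 u) \<and> A (m0 u - 1) + of_int (l u :: int) < 0 \<and> 0 \<le> A (m0 u) + of_int (l u)"
    by metis
  define lv :: "nat \<Rightarrow> real option" where "lv u = (if u \<in> W then Some 0 else None)" for u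
  define loc :: "real \<Rightarrow> state" where
    "loc t u = (if u \<in> V then Some (s (idx (t - of_int (l u)))) else None)" for t u
  have dom_lv: "dom lv = W"
    by (auto simp: lv_def split: if_splits)

  have left_tokens: "if u \<in> V then \<exists>m. after_leave lv t x u = Some (s m) \<and>
        A (m - 1) + of_int (l u) < t \<and> t \<le> A m + of_int (l u)
      else after_leave lv t x u = None"
    if "left_state n loc t x" "0 \<le> t" for t x u
  proof (cases "t = 0")
    case True
    then have x: "x = init_state n"
      using that(1) by (simp add: left_state_def)
    show ?thesis
    proof (cases "u \<in> V")
      case True
      then have "after_leave lv t x u = Some u"
        using x by (simp add: after_leave_def lv_def init_state_def V_def)
      with start[OF True] True \<open>t = 0\<close> show ?thesis by auto
    next
      case False
      then have "after_leave lv t x u = None"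
        using x \<open>t = 0\<close> by (auto simp: after_leave_def lv_def init_state_def V_def)
      with False show ?thesis by simp
    qed
  next
    case False
    then have "0 < t" using that(2) by simp
    note ev = left_state_eventually[OF that(1) this]
    show ?thesis
    proof (cases "u \<in> V")
      case True
      obtain m where m: "A (m - 1) + of_int (l u) < t" "t \<le> A m + of_int (l u)"
        using ex_left_index[of "t - of_int (l u)"] by (auto simp: algebra_simps)
      have "\<forall>\<^sub>F w in at_left t. loc w = x \<and> idx (w - of_int (l u)) = m"
        using ev eventually_idx_eq_left[OF m] by (rule eventually_conj)
      then obtain w where "loc w = x" "idx (w - of_int (l u)) = m"
        using eventually_happens[of _ "at_left t"] by force
      then have "x u = Some (s m)"
        using True by (auto simp: loc_def)
      then have "after_leave lv t x u = Some (s m)"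
        using True by (simp add: after_leave_def lv_def V_def)
      with m True show ?thesis by auto
    next
      case False
      obtain w where "loc w = x"
        using eventually_happens[OF ev] by force
      then have "x u = None"
        using False by (auto simp: loc_def)
      with False show ?thesis by (simp add: after_leave_def)
    qed
  qed

  have no_meeting: "\<not> occupied (after_leave lv t x) j"
    if x: "left_state n loc t x" "0 \<le> t" and u: "after_leave lv t x u = Some i"
      and j: "adj n c r i j" "pos f g i t = lk c i j" for t x u i j
  proof
    assume "occupied (after_leave lv t x) j"
    then obtain v where v: "after_leave lv t x v = Some j"
      by (auto simp: occupied_def)
    obtain m where m: "i = s m" "A (m - 1) + of_int (l u) < t" "t \<le> A m + of_int (l u)"
      using left_tokens[OF x, of u] u by (auto split: if_splits)
    obtain m' where m': "j = s m'" "A (m' - 1) + of_int (l v) < t" "t \<le> A m' + of_int (l v)"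
      using left_tokens[OF x, of v] v by (auto split: if_splits)
    have "j = s (m + 1)" and t: "t = A m + of_int (l u)"
      using at_link_iff[OF m(2,3), of j] j m(1) by auto
    then obtain d :: int where d: "A m' = A (m + 1) + of_int d" "A (m' - 1) = A m + of_int d"
      using A_cong[of m' "m + 1"] m'(1) by auto
    \<comment> \<open>\<open>v\<close> would have entered circle \<open>j\<close> strictly before
      \<open>t\<close>, at a time differing from \<open>t\<close> by an integer, yet it stays there
      for less than one unit.\<close>
    have "of_int (d + l v) < (of_int (l u) :: real)" "(of_int (l u) :: real) < of_int (d + l v + 1)"
      using m'(2,3) d t A_upper[of "m + 1"] by simp_all
    then have "d + l v < l u" "l u < d + l v + 1"
      by (simp_all only: of_int_less_iff)
    then show False by simp
  qed

  have step_loc: "step n c r f g lv t x = loc t" if x: "left_state n loc t x" "0 \<le> t" for t x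
  proof
    fix u
    show "step n c r f g lv t x u = loc t u"
    proof (cases "u \<in> V")
      case True
      then obtain m where m: "after_leave lv t x u = Some (s m)"
          "A (m - 1) + of_int (l u) < t" "t \<le> A m + of_int (l u)"
        using left_tokens[OF x, of u] by auto
      have "\<not> occupied (after_leave lv t x) (s (m + 1))" if "t = A m + of_int (l u)"
        using no_meeting[OF x m(1), of "s (m + 1)"] at_link_iff[OF m(2,3), of "s (m + 1)"] that
        by simp
      then show ?thesis
        using step_token[OF m] idx_after_left[OF m(2,3)] True by (auto simp: loc_def)
    next
      case False
      then have "after_leave lv t x u = None"
        using left_tokens[OF x, of u] by simp
      with False show ?thesis
        by (simp add: loc_def step_eq_None_iff)
    qed
  qed

  have "is_run n c r f g lv loc"
    unfolding is_run_def
  proof (intro allI impI conjI)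
    fix t :: real assume "0 \<le> t"
    have "\<exists>e. \<forall>u. e u > 0 \<and>
        (\<forall>w. t \<le> w \<and> w < t + e u \<longrightarrow> idx (w - of_int (l u)) = idx (t - of_int (l u)))"
      using idx_right_constant by (intro choice allI)
    then obtain e where e: "\<And>u. e u > 0"
      "\<And>u w. t \<le> w \<Longrightarrow> w < t + e u \<Longrightarrow> idx (w - of_int (l u)) = idx (t - of_int (l u))"
      by blast
    \<comment> \<open>The 1 keeps the minimum defined when nobody survives.\<close>
    define d where "d = Min (insert 1 (e ` V))"
    have "d > 0"
      using \<open>finite V\<close> e(1) by (simp add: d_def)
    moreover have "loc w = loc t" if "t \<le> w" "w < t + d" for w
    proof
      fix u
      show "loc w u = loc t u"
      proof (cases "u \<in> V")
        case True
        then have "d \<le> e u"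
          using \<open>finite V\<close> by (simp add: d_def)
        then show ?thesis
          using e(2)[of w u] that True by (simp add: loc_def)
      qed (simp add: loc_def)
    qed
    ultimately show "\<exists>\<epsilon>>0. \<forall>w. t \<le> w \<and> w < t + \<epsilon> \<longrightarrow> loc w = loc t"
      by blast
  next
    fix t :: real assume "0 \<le> t"
    have "\<exists>x. left_state n loc t x"
    proof (cases "t = 0")
      case True
      then show ?thesis by (auto simp: left_state_def)
    next
      case False
      have "\<exists>m. \<forall>u. A (m u - 1) + of_int (l u) < t \<and> t \<le> A (m u) + of_int (l u)"
        using ex_left_index[of "t - of_int (l _)"] by (intro choice allI) (simp add: algebra_simps)
      then obtain m where m: "\<And>u. A (m u - 1) + of_int (l u) < t" "\<And>u. t \<le> A (m u) + of_int (l u)"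
        by blast
      have "\<forall>\<^sub>F w in at_left t. \<forall>u\<in>V. idx (w - of_int (l u)) = m u"
        using \<open>finite V\<close> m by (intro eventually_ball_finite ballI eventually_idx_eq_left)
      then have "\<forall>\<^sub>F w in at_left t. loc w = (\<lambda>u. if u \<in> V then Some (s (m u)) else None)"
        by eventually_elim (auto simp: loc_def)
      then show ?thesis
        using False \<open>0 \<le> t\<close> by (intro exI left_stateI_eventually) auto
    qed
    then show "\<exists>x. left_state n loc t x \<and> loc t = step n c r f g lv t x"
      using step_loc[OF _ \<open>0 \<le> t\<close>] by metis
  qed
  moreover have "starvation_from n c r f g lv loc 0"
    using no_meeting unfolding starvation_from_def by blast
  ultimately show ?thesis
    using W dom_lv unfolding falls_into_starvation_def
    by (intro exI[of _ lv] exI[of _ loc]) (auto simp: lv_def split: if_splits)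
qed

section \<open>The rings as point sets\<close>

lemma lk_succ_eq_rotation:
  "lk c (s m) (s (m + 1)) =
    lk c (s m) (s (m - 1)) * cis (of_int (g (s m)) * (2 * pi * (A m - A (m - 1))))"
  unfolding lk_succ lk_pred pos_shift[symmetric] by simp

lemma norm_lk_pred: "cmod (lk c (s m) (s (m - 1))) = 1"
  by (simp add: lk_pred pos_def)

lemma g_sign: "of_int (g (s m)) = (1 :: real) \<or> of_int (g (s m)) = (-1 :: real)"
  using g_cases[OF s_less[of m]] by auto

lemma fdist_pred_succ:
  "fdist (of_int (g (s m))) (lk c (s m) (s (m - 1))) (lk c (s m) (s (m + 1))) =
    2 * pi * (A m - A (m - 1))"
  by (rule fdist_eq[OF g_sign norm_lk_pred lk_succ_eq_rotation])
    (use A_less[of m] A_upper[of m] in simp_all)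

text \<open>\<open>fdist\<close> never takes the value 0, so a link comes last when links are
  ordered by distance from itself.\<close>

lemma fdist_pred_pred:
  "fdist (of_int (g (s m))) (lk c (s m) (s (m - 1))) (lk c (s m) (s (m - 1))) = 2 * pi"
proof (rule fdist_eq[OF g_sign norm_lk_pred])
  have "cis (of_int (g (s m)) * (2 * pi)) = 1"
    using g_sign[of m] by (auto simp: complex_eq_iff)
  then show "lk c (s m) (s (m - 1)) =
      lk c (s m) (s (m - 1)) * cis (of_int (g (s m)) * (2 * pi))"
    by simp
qed simp_all

text \<open>Against the direction of motion the complementary arc is traversed; this compares
  schedules with opposite directions.\<close>

lemma fdist_reversed:
  "fdist (- of_int (g (s m))) (lk c (s m) (s (m - 1))) (lk c (s m) (s (m + 1))) =
    2 * pi * (1 - (A m - A (m - 1)))"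
proof (rule fdist_eq[OF _ norm_lk_pred])
  have "cis (of_int (g (s m)) * (2 * pi * (A m - A (m - 1)))) =
      cis (- of_int (g (s m)) * (2 * pi * (1 - (A m - A (m - 1)))))"
    unfolding cis_eq_cis_iff by (intro exI[of _ "g (s m)"]) (simp add: algebra_simps)
  then show "lk c (s m) (s (m + 1)) = lk c (s m) (s (m - 1)) *
      cis (- of_int (g (s m)) * (2 * pi * (1 - (A m - A (m - 1)))))"
    using lk_succ_eq_rotation by simp
qed (use g_sign[of m] A_less[of m] A_upper[of m] in auto)

lemma next_link_pred_iff: "next_link n c r g (s m) (s (m - 1)) j \<longleftrightarrow> j = s (m + 1)"
proof -
  have "2 * pi * (A m - A (m - 1)) < 2 * pi * 1"
    using A_upper[of m] by (intro mult_strict_left_mono) auto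
  then show ?thesis
    using s_succ_neq[of m] unfolding next_link_def adj_s_iff
    by (auto simp: fdist_pred_succ fdist_pred_pred)
qed

lemma next_link_succ_iff: "next_link n c r g (s m) (s (m + 1)) j \<longleftrightarrow> j = s (m - 1)"
proof -
  interpret M: scs_cycle n c r "\<lambda>m. s (- m)" f g "\<lambda>m. A (- m - 1) + (of_int m + 1)" "int n - N"
    by (rule mirror)
  show ?thesis
    using M.next_link_pred_iff[of "- m" j] by (simp add: add.commute)
qed

definition forward_dart :: "int \<Rightarrow> nat \<times> nat" where
  "forward_dart m = (s m, s (m - 1))"

definition forward_ring :: "(nat \<times> complex) set" where
  "forward_ring = \<Union> (arc n c r g ` range forward_dart)"

lemma dart_next_from_forward:
  "(forward_dart m, d) \<in> dart_next n c r g \<longleftrightarrow> d = forward_dart (m + 1)"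
  by (auto simp: dart_next_def forward_dart_def next_link_pred_iff)

text \<open>Needed because \<open>ring_darts\<close> also closes under predecessors. A dart of
  \<open>s (m - 1)\<close> starting at the link to \<open>s m\<close> would exit towards
  \<open>s (m - 2)\<close>, which differs from \<open>s m\<close> as \<open>n\<close> is at least
  3.\<close>

lemma dart_next_to_forward:
  assumes "(d, forward_dart m) \<in> dart_next n c r g"
  shows "d = forward_dart (m - 1)"
proof -
  obtain k where d: "d = (s (m - 1), k)" and next_link: "next_link n c r g (s (m - 1)) k (s m)"
    using assms unfolding dart_next_def forward_dart_def by blast
  from next_link have "adj n c r (s (m - 1)) k"
    by (simp add: next_link_def)
  then consider "k = s (m - 2)" | "k = s m"
    using adj_s_iff[of "m - 1" k] by auto
  then show ?thesis
  proof cases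
    case 1
    with d show ?thesis by (simp add: forward_dart_def)
  next
    case 2
    then have "s m = s (m - 2)"
      using next_link next_link_succ_iff[of "m - 1" "s m"] by simp
    then show ?thesis
      using s_succ_neq(2)[of "m - 1"] by simp
  qed
qed

lemma ring_darts_forward: "ring_darts n c r g (forward_dart m) = range forward_dart"
proof (intro set_eqI iffI)
  fix d assume "d \<in> ring_darts n c r g (forward_dart m)"
  then have "(forward_dart m, d) \<in> (dart_next n c r g \<union> (dart_next n c r g)\<inverse>)\<^sup>*"
    by (simp add: ring_darts_def)
  then show "d \<in> range forward_dart"
  proof induction
    case (step d d')
    then obtain m where "d = forward_dart m" by blast
    with step(2) show ?case
      using dart_next_from_forward dart_next_to_forward by blast
  qed simp
next
  let ?R = "dart_next n c r g \<union> (dart_next n c r g)\<inverse>"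
  have edge: "(forward_dart k, forward_dart (k + 1)) \<in> dart_next n c r g" for k
    by (simp add: dart_next_from_forward)
  have "(forward_dart m, forward_dart k) \<in> ?R\<^sup>*" for k
  proof (induction k rule: int_induct[of _ m])
    case (step1 k)
    then show ?case
      using edge[of k] by (meson UnI1 rtrancl.rtrancl_into_rtrancl)
  next
    case (step2 k)
    then show ?case
      using edge[of "k - 1"] by (simp add: rtrancl.rtrancl_into_rtrancl)
  qed simp
  then show "d \<in> ring_darts n c r g (forward_dart m)" if "d \<in> range forward_dart" for d
    using that by (auto simp: ring_darts_def)
qed

text \<open>Arcs contain both end points, so both inequalities are weak here, in contrast to
  \<open>forward\<close>.\<close>

lemma in_forward_ring_iff:
  assumes "i < n"
  shows "(i, pos f g i t) \<in> forward_ring \<longleftrightarrow>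
    (\<exists>m k::int. i = s m \<and> A (m - 1) + of_int k \<le> t \<and> t \<le> A m + of_int k)"
proof -
  have arc: "arc n c r g (forward_dart m) =
      {(s m, pos f g (s m) (A (m - 1)) * cis (of_int (g (s m)) * x)) | x.
        0 \<le> x \<and> x \<le> 2 * pi * (A m - A (m - 1))}" for m
    by (auto simp: arc_def forward_dart_def next_link_pred_iff fdist_pred_succ lk_pred[symmetric])
  have "(s m, pos f g (s m) t) \<in> arc n c r g (forward_dart m) \<longleftrightarrow>
      (\<exists>k::int. A (m - 1) + of_int k \<le> t \<and> t \<le> A m + of_int k)" for m
  proof -
    have "(s m, pos f g (s m) t) \<in> arc n c r g (forward_dart m) \<longleftrightarrow>
        (\<exists>x. pos f g (s m) t = pos f g (s m) (A (m - 1)) * cis (of_int (g (s m)) * x) \<and>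
          0 \<le> x \<and> x \<le> 2 * pi * (A m - A (m - 1)))"
      unfolding arc by auto
    also have "\<dots> \<longleftrightarrow> (\<exists>y. pos f g (s m) t = pos f g (s m) (A (m - 1) + y) \<and>
        0 \<le> y \<and> y \<le> A m - A (m - 1))"
    proof
      assume "\<exists>x. pos f g (s m) t = pos f g (s m) (A (m - 1)) * cis (of_int (g (s m)) * x) \<and>
          0 \<le> x \<and> x \<le> 2 * pi * (A m - A (m - 1))"
      then obtain x where "pos f g (s m) t = pos f g (s m) (A (m - 1)) * cis (of_int (g (s m)) * x)"
        "0 \<le> x" "x \<le> 2 * pi * (A m - A (m - 1))"
        by blast
      then have "pos f g (s m) t = pos f g (s m) (A (m - 1) + x / (2 * pi))"
        "0 \<le> x / (2 * pi)" "x / (2 * pi) \<le> A m - A (m - 1)"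
        by (simp_all add: pos_shift divide_le_eq mult.commute)
      then show "\<exists>y. pos f g (s m) t = pos f g (s m) (A (m - 1) + y) \<and>
          0 \<le> y \<and> y \<le> A m - A (m - 1)"
        by blast
    next
      assume "\<exists>y. pos f g (s m) t = pos f g (s m) (A (m - 1) + y) \<and>
          0 \<le> y \<and> y \<le> A m - A (m - 1)"
      then obtain y where "pos f g (s m) t = pos f g (s m) (A (m - 1) + y)"
        "0 \<le> y" "y \<le> A m - A (m - 1)"
        by blast
      then show "\<exists>x. pos f g (s m) t = pos f g (s m) (A (m - 1)) * cis (of_int (g (s m)) * x) \<and>
          0 \<le> x \<and> x \<le> 2 * pi * (A m - A (m - 1))"
        by (intro exI[of _ "2 * pi * y"]) (simp add: pos_shift)
    qed
    also have "\<dots> \<longleftrightarrow> (\<exists>y. t - (A (m - 1) + y) \<in> \<int> \<and> 0 \<le> y \<and> y \<le> A m - A (m - 1))"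
      using pos_eq_iff[of g "s m" f t] g_cases[OF s_less] by simp
    also have "\<dots> \<longleftrightarrow> (\<exists>k::int. A (m - 1) + of_int k \<le> t \<and> t \<le> A m + of_int k)"
    proof
      assume "\<exists>y. t - (A (m - 1) + y) \<in> \<int> \<and> 0 \<le> y \<and> y \<le> A m - A (m - 1)"
      then obtain y k where "t - (A (m - 1) + y) = of_int k" "0 \<le> y" "y \<le> A m - A (m - 1)"
        by (auto elim: Ints_cases)
      then show "\<exists>k::int. A (m - 1) + of_int k \<le> t \<and> t \<le> A m + of_int k"
        by (intro exI[of _ k]) linarith
    next
      assume "\<exists>k::int. A (m - 1) + of_int k \<le> t \<and> t \<le> A m + of_int k"
      then obtain k :: int where "A (m - 1) + of_int k \<le> t" "t \<le> A m + of_int k"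
        by blast
      then show "\<exists>y. t - (A (m - 1) + y) \<in> \<int> \<and> 0 \<le> y \<and> y \<le> A m - A (m - 1)"
        by (intro exI[of _ "t - of_int k - A (m - 1)"]) auto
    qed
    finally show ?thesis .
  qed
  moreover have "(i, z) \<in> arc n c r g (forward_dart m) \<Longrightarrow> i = s m" for z m
    unfolding arc by auto
  ultimately show ?thesis
    unfolding forward_ring_def by blast
qed

text \<open>At a generic time no robot is at a link, and the closed arcs give the same count as the
  half-open intervals.\<close>

lemma robots_in_forward_ring:
  assumes "generic_time n c r f g t"
  shows "int (robots_in n f g forward_ring t) = N"
proof -
  have generic: "t \<noteq> A m + of_int k" for m and k :: int
  proof
    assume "t = A m + of_int k"
    then have "pos f g (s m) t = lk c (s m) (s (m + 1))"
      by (simp add: pos_eq_lk_succ_iff)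
    moreover have "adj n c r (s m) (s (m + 1))"
      by (simp add: adj_s_iff)
    ultimately show False
      using assms unfolding generic_time_def by blast
  qed
  have "u < n \<and> (u, pos f g u t) \<in> forward_ring \<longleftrightarrow> forward t u" for u
  proof (cases "u < n")
    case True
    then show ?thesis
      using generic unfolding in_forward_ring_iff[OF True] forward_def
      by (metis order_le_less)
  next
    case False
    then show ?thesis using forward_less by blast
  qed
  then show ?thesis
    using card_forward[of t] by (simp add: robots_in_def)
qed

text \<open>Each dart starts at the link to the predecessor or at the link to the successor; the
  latter are the forward darts of the mirrored enumeration.\<close>

lemma rings_eq:
  "rings n c r g = {forward_ring,
     scs_cycle.forward_ring n c r (\<lambda>m. s (- m)) g}"
proof -
  interpret M: scs_cycle n c r "\<lambda>m. s (- m)" f g "\<lambda>m. A (- m - 1) + (of_int m + 1)" "int n - N"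
    by (rule mirror)
  have dart: "dart n c r d \<longleftrightarrow> (\<exists>m. d = forward_dart m \<or> d = M.forward_dart m)" for d
  proof
    assume "dart n c r d"
    then obtain m where "d = (s m, s (m + 1)) \<or> d = (s (m + 1), s m)"
      unfolding dart_def adj_iff by (metis prod.collapse)
    then have "d = M.forward_dart (- m) \<or> d = forward_dart (m + 1)"
      by (auto simp: forward_dart_def M.forward_dart_def add.commute)
    then show "\<exists>m. d = forward_dart m \<or> d = M.forward_dart m" by blast
  next
    assume "\<exists>m. d = forward_dart m \<or> d = M.forward_dart m"
    then obtain m where "d = (s m, s (m - 1)) \<or> d = (s (- m), s (1 - m))"
      by (auto simp: forward_dart_def M.forward_dart_def)
    then show "dart n c r d"
      by (auto simp: dart_def adj_s_iff)
  qed
  have "rings n c r g = (\<lambda>d. \<Union> (arc n c r g ` ring_darts n c r g d)) `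
      (range forward_dart \<union> range M.forward_dart)"
    unfolding rings_def dart by blast
  also have "\<dots> = {forward_ring, M.forward_ring}"
    unfolding image_Un image_image ring_darts_forward M.ring_darts_forward
    by (auto simp: forward_ring_def M.forward_ring_def)
  finally show ?thesis .
qed

lemma ring_counts:
  assumes "generic_time n c r f g t" "rings n c r g = {a, b}"
  shows "int (min (robots_in n f g a t) (robots_in n f g b t)) = min N (int n - N)"
proof -
  interpret M: scs_cycle n c r "\<lambda>m. s (- m)" f g "\<lambda>m. A (- m - 1) + (of_int m + 1)" "int n - N"
    by (rule mirror)
  have "{a, b} = {forward_ring, M.forward_ring}"
    using assms(2) rings_eq by simp
  then have "a = forward_ring \<and> b = M.forward_ring \<or> a = M.forward_ring \<and> b = forward_ring"
    by (auto simp: doubleton_eq_iff)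
  then show ?thesis
    using robots_in_forward_ring[OF assms(1)] M.robots_in_forward_ring[OF assms(1)] by auto
qed

section \<open>Independence of the schedule\<close>

text \<open>Directions alternate around the cycle, so two schedules agree up to a global sign
  \<open>e\<close>. The increments of \<open>A\<close> are angles between links, fixed by the
  geometry; reversal replaces each by its complement to a full turn.\<close>

lemma ring_size_unique:
  assumes "scs_cycle n c r s f' g' A' N'"
  shows "N' = N \<or> N' = int n - N"
proof -
  interpret S: scs_cycle n c r s f' g' A' N' by (rule assms)
  define e where "e = g' (s 0) * g (s 0)"
  have g0: "g (s 0) = 1 \<or> g (s 0) = -1" and g'0: "g' (s 0) = 1 \<or> g' (s 0) = -1"
    using g_cases[OF s_less] S.g_cases[OF s_less] by blast+
  then have e: "e = 1 \<or> e = -1"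
    by (auto simp: e_def)
  have ge: "g' (s m) = e * g (s m)" for m
  proof (induction m rule: int_induct[of _ 0])
    case base
    then show ?case using g0 by (auto simp: e_def)
  next
    case (step1 m)
    then show ?case using g_alternates[of m] S.g_alternates[of m] by simp
  next
    case (step2 m)
    then show ?case using g_alternates[of "m - 1"] S.g_alternates[of "m - 1"] by simp
  qed
  have "A (int k) - A 0 = A' (int k) - A' 0" if "e = 1" for k
  proof (induction k)
    case (Suc k)
    have "g' (s (int k + 1)) = g (s (int k + 1))"
      using ge[of "int k + 1"] that by simp
    then have "A (int k + 1) - A (int k) = A' (int k + 1) - A' (int k)"
      using fdist_pred_succ[of "int k + 1"] S.fdist_pred_succ[of "int k + 1"] by simp
    with Suc show ?case by (simp add: add.commute)
  qed simp
  moreover have "A (int k) - A 0 = of_nat k - (A' (int k) - A' 0)" if "e = -1" for k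
  proof (induction k)
    case (Suc k)
    have "g' (s (int k + 1)) = - g (s (int k + 1))"
      using ge[of "int k + 1"] that by simp
    then have "A' (int k + 1) - A' (int k) = 1 - (A (int k + 1) - A (int k))"
      using fdist_reversed[of "int k + 1"] S.fdist_pred_succ[of "int k + 1"] by simp
    with Suc show ?case by (simp add: add.commute)
  qed simp
  ultimately have "A (int n) - A 0 = A' (int n) - A' 0 \<or>
      A (int n) - A 0 = of_nat n - (A' (int n) - A' 0)"
    using e by blast
  then have "(of_int N :: real) = of_int N' \<or> (of_int N :: real) = of_int (int n - N')"
    using A_period[of 0] S.A_period[of 0] by simp
  then show ?thesis
    by linarith
qed

end

section \<open>Existence of the lifted crossing times\<close>

context cycle_graph
begin

text \<open>Two neighbours in the same direction are at a distance equal to the difference of their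
  distances from \<open>s m\<close>, hence adjacent. The cycle is then a triangle, on which
  directions cannot alternate.\<close>

lemma lk_succ_neq_lk_pred:
  assumes disjoint: "disjoint_unit_circles n c"
    and sync: "sync_schedule n c r f g"
  shows "lk c (s m) (s (m + 1)) \<noteq> lk c (s m) (s (m - 1))"
proof
  assume eq: "lk c (s m) (s (m + 1)) = lk c (s m) (s (m - 1))"
  define a where "a = c (s (m + 1)) - c (s m)"
  define b where "b = c (s (m - 1)) - c (s m)"
  have a: "cmod a \<le> 2 + r" and b: "cmod b \<le> 2 + r"
    using adj_s_iff[of m "s (m + 1)"] adj_s_iff[of m "s (m - 1)"]
    unfolding adj_def a_def b_def by (simp_all add: norm_minus_commute)
  have "2 < cmod a"
    using disjoint s_succ_neq(1)[of m] unfolding disjoint_unit_circles_def a_def by simp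
  then have sgn_a: "cmod (sgn a) = 1"
    by (auto simp: norm_sgn)
  have "sgn a = sgn b"
    using eq by (simp add: lk_def a_def b_def)
  moreover have "x = cmod x *\<^sub>R sgn x" for x
    by (cases "x = 0") (simp_all add: sgn_div_norm)
  ultimately have "a - b = (cmod a - cmod b) *\<^sub>R sgn a"
    by (metis scaleR_left_diff_distrib)
  then have "cmod (a - b) = \<bar>cmod a - cmod b\<bar>"
    using sgn_a by simp
  also have "\<dots> \<le> 2 + r"
    using a b norm_ge_zero[of a] norm_ge_zero[of b] by linarith
  finally have "adj n c r (s (m + 1)) (s (m - 1))"
    using s_succ_neq(2)[of m] by (simp add: adj_def a_def b_def)
  then have "s (m - 1) = s (m + 2)"
    using adj_s_iff[of "m + 1" "s (m - 1)"] s_succ_neq(1)[of "m - 1"] by (auto simp: algebra_simps)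
  moreover have alt: "g (s (k + 1)) = - g (s k)" for k
    using sync adj_s_iff[of "k + 1" "s k"] unfolding sync_schedule_def by simp
  ultimately have "g (s m) = - g (s m)"
    using alt[of "m - 1"] alt[of m] alt[of "m + 1"] by (simp add: algebra_simps)
  moreover have "g (s m) = 1 \<or> g (s m) = -1"
    using sync unfolding sync_schedule_def by simp
  ultimately show False by auto
qed

lemma scs_cycle_exists:
  assumes disjoint: "disjoint_unit_circles n c"
    and sync: "sync_schedule n c r f g"
  shows "\<exists>A N. scs_cycle n c r s f g A N"
proof -
  have g: "g i = 1 \<or> g i = -1" if "i < n" for i
    using sync that unfolding sync_schedule_def by simp
  define time where "time i j = (SOME t. pos f g i t = lk c i j)" for i j
  define T where "T m = time (s m) (s (m + 1))" for m
  have T_succ: "pos f g (s m) (T m) = lk c (s m) (s (m + 1))" for m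
  proof -
    have "2 < cmod (c (s (m + 1)) - c (s m))"
      using disjoint s_succ_neq(1)[of m] unfolding disjoint_unit_circles_def by simp
    then have "c (s (m + 1)) - c (s m) \<noteq> 0"
      by auto
    then have "cmod (lk c (s m) (s (m + 1))) = 1"
      by (simp add: lk_def norm_sgn)
    then have "\<exists>t. pos f g (s m) t = lk c (s m) (s (m + 1))"
      using g by (intro pos_surj) auto
    then show ?thesis
      unfolding T_def time_def by (rule someI_ex)
  qed
  have T_pred: "pos f g (s m) (T (m - 1)) = lk c (s m) (s (m - 1))" for m
    using sync T_succ[of "m - 1"] adj_s_iff[of m "s (m - 1)"]
    unfolding sync_schedule_def by (metis diff_add_cancel)
  have T_period: "T (m + int n) = T m" for m
    using s_add_period[of "m + 1"] by (simp add: T_def algebra_simps)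
  \<comment> \<open>The crossing times \<open>T\<close> matter only modulo 1. Fractional parts fix
    the increments, which are nonzero because the two links of a circle differ.\<close>
  define D where "D m = frac (T m - T (m - 1))" for m
  have D_period: "D (m + int n) = D m" for m
    using T_period[of m] T_period[of "m - 1"] by (simp add: D_def algebra_simps)
  have "T m - T (m - 1) \<notin> \<int>" for m
    using lk_succ_neq_lk_pred[OF assms, of m] T_succ[of m] T_pred[of m]
      pos_eq_iff[of g "s m" f "T m" "T (m - 1)"] g[of "s m"] by simp
  then have D: "0 < D m" "D m < 1" for m
    by (simp_all add: D_def frac_lt_1 frac_gt_0_iff)
  obtain A where A: "A 0 = T 0" "\<And>m. A m = A (m - 1) + D m"
    using int_antidifference by blast
  have AT: "A m - T m \<in> \<int>" for m
  proof -
    have step: "A m - T m \<in> \<int> \<longleftrightarrow> A (m - 1) - T (m - 1) \<in> \<int>" for m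
    proof -
      have "A m - T m = (A (m - 1) - T (m - 1)) - of_int \<lfloor>T m - T (m - 1)\<rfloor>"
        using A(2)[of m] by (simp add: D_def frac_def)
      then show ?thesis
        by (simp only: diff_in_Ints_iff_right Ints_of_int)
    qed
    show ?thesis
    proof (induction m rule: int_induct[of _ 0])
      case base
      then show ?case using A(1) by simp
    next
      case (step1 m)
      then show ?case using step[of "m + 1"] by simp
    next
      case (step2 m)
      then show ?case using step[of m] by simp
    qed
  qed
  \<comment> \<open>The length of a ring is a whole number of turns: \<open>A\<close> agrees with
    the periodic \<open>T\<close> modulo 1.\<close>
  have "A (int n) - A 0 \<in> \<int>"
    using Ints_diff[OF AT[of "int n"] AT[of 0]] T_period[of 0] A(1) by simp
  then obtain N where N: "A (int n) - A 0 = of_int N"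
    by (auto elim: Ints_cases)
  have A_period: "A (m + int n) = A m + of_int N" for m
  proof (induction m rule: int_induct[of _ 0])
    case base
    then show ?case using N by simp
  next
    case (step1 m)
    then show ?case
      using A(2)[of "m + 1"] A(2)[of "m + 1 + int n"] D_period[of "m + 1"] by (simp add: algebra_simps)
  next
    case (step2 m)
    then show ?case
      using A(2)[of m] A(2)[of "m + int n"] D_period[of m] by (simp add: algebra_simps)
  qed
  have pos_A: "pos f g (s m) (A k) = pos f g (s m) (T k)" for m k
    using pos_eq_iff[of g "s m" f "A k" "T k"] g AT by simp
  have "scs_cycle n c r s f g A N"
  proof unfold_locales
    show "g (s (m + 1)) = - g (s m)" for m
      using sync adj_s_iff[of "m + 1" "s m"] unfolding sync_schedule_def by simp
    show "lk c (s m) (s (m + 1)) = pos f g (s m) (A m)" for m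
      by (simp add: pos_A T_succ)
    show "lk c (s m) (s (m - 1)) = pos f g (s m) (A (m - 1))" for m
      by (simp add: pos_A T_pred)
    show "A (m - 1) < A m" "A m < A (m - 1) + 1" for m
      using A(2)[of m] D[of m] by simp_all
  qed (use g A_period in auto)
  then show ?thesis by blast
qed

end

section \<open>From the cycle graph to the theorem\<close>

lemma cycle_graph_enumeration:
  assumes "is_cycle_graph n (adj n c r)"
  shows "\<exists>s. cycle_graph n c r s"
proof -
  obtain \<sigma> where n: "3 \<le> n" and \<sigma>: "bij_betw \<sigma> {..<n} {..<n}"
    and adj: "\<And>i j. adj n c r i j \<longleftrightarrow> (\<exists>m<n. (i = \<sigma> m \<and> j = \<sigma> ((m + 1) mod n)) \<or>
                                   (j = \<sigma> m \<and> i = \<sigma> ((m + 1) mod n)))"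
    using assms unfolding is_cycle_graph_def by blast
  define s where "s m = \<sigma> (nat (m mod int n))" for m
  have less: "nat (m mod int n) < n" for m
    using n by (simp add: nat_less_iff)
  have s_small: "s (int m) = \<sigma> m" if "m < n" for m
    using that by (simp add: s_def)
  have s_small_succ: "s (int m + 1) = \<sigma> ((m + 1) mod n)" for m
  proof -
    have "nat ((int m + 1) mod int n) = (m + 1) mod n"
      by (metis nat_int of_nat_1 of_nat_add of_nat_mod)
    then show ?thesis by (simp add: s_def)
  qed
  have s_mod: "s (m mod int n + d) = s (m + d)" for m d
    by (simp add: s_def mod_add_left_eq)
  have "cycle_graph n c r s"
  proof
    show "s m = s m' \<longleftrightarrow> int n dvd m - m'" for m m'
    proof -
      have "s m = s m' \<longleftrightarrow> nat (m mod int n) = nat (m' mod int n)"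
        using \<sigma> less unfolding s_def bij_betw_def by (metis inj_on_eq_iff lessThan_iff)
      also have "\<dots> \<longleftrightarrow> m mod int n = m' mod int n"
        using n by (simp add: nat_eq_iff)
      finally show ?thesis
        by (simp add: mod_eq_dvd_iff)
    qed
    show "range s = {..<n}"
    proof
      show "range s \<subseteq> {..<n}"
        using \<sigma> less unfolding s_def bij_betw_def by blast
      show "{..<n} \<subseteq> range s"
      proof
        fix i assume "i \<in> {..<n}"
        then obtain m where "m < n" "i = \<sigma> m"
          using \<sigma> unfolding bij_betw_def by blast
        then show "i \<in> range s"
          using s_small by (metis rangeI)
      qed
    qed
    show "adj n c r i j \<longleftrightarrow> (\<exists>m. i = s m \<and> j = s (m + 1) \<or> j = s m \<and> i = s (m + 1))" for i j
    proof
      assume "adj n c r i j"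
      then show "\<exists>m. i = s m \<and> j = s (m + 1) \<or> j = s m \<and> i = s (m + 1)"
        unfolding adj using s_small s_small_succ by metis
    next
      assume "\<exists>m. i = s m \<and> j = s (m + 1) \<or> j = s m \<and> i = s (m + 1)"
      then obtain m where m: "i = s m \<and> j = s (m + 1) \<or> j = s m \<and> i = s (m + 1)"
        by blast
      define k where "k = nat (m mod int n)"
      have "int k = m mod int n"
        using n by (simp add: k_def)
      then have "s m = \<sigma> k" "s (m + 1) = \<sigma> ((k + 1) mod n)"
        using s_small_succ[of k] s_mod[of m 1] by (simp_all add: s_def k_def)
      with m less[of m] show "adj n c r i j"
        unfolding adj k_def[symmetric] by blast
    qed
  qed (rule n)
  then show ?thesis by blast
qed

theorem theorem8:
  fixes n :: nat and c :: "nat \<Rightarrow> complex" and r :: real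
    and f :: "nat \<Rightarrow> real" and g :: "nat \<Rightarrow> int"
    and a b :: "(nat \<times> complex) set" and t :: real
  assumes "0 < r"
    and "disjoint_unit_circles n c"
    and "is_cycle_graph n (adj n c r)"
    and "sync_schedule n c r f g"
    and "rings n c r g = {a, b}" and "a \<noteq> b"
    and "generic_time n c r f g t"
  shows "int (isolation_resilience n c r) =
           int (min (robots_in n f g a t) (robots_in n f g b t)) - 1"
proof -
  obtain s where "cycle_graph n c r s"
    using cycle_graph_enumeration[OF assms(3)] by blast
  then interpret cycle_graph n c r s .
  obtain A N where "scs_cycle n c r s f g A N"
    using scs_cycle_exists[OF assms(2,4)] by blast
  then interpret scs_cycle n c r s f g A N .
  interpret M: scs_cycle n c r "\<lambda>m. s (- m)" f g "\<lambda>m. A (- m - 1) + (of_int m + 1)" "int n - N"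
    by (rule mirror)
  have resilient: "resilient_to n c r k \<longleftrightarrow> int k < min N (int n - N)" if "k \<le> n" for k
  proof
    assume resilient: "resilient_to n c r k"
    show "int k < min N (int n - N)"
    proof (rule ccontr)
      assume "\<not> int k < min N (int n - N)"
      then have "int n - N \<le> int k \<or> int n - (int n - N) \<le> int k"
        by linarith
      then have "\<exists>lv loc. dom lv \<subseteq> {..<n} \<and> card (dom lv) = k \<and>
          (\<forall>u \<tau>. lv u = Some \<tau> \<longrightarrow> 0 \<le> \<tau>) \<and> is_run n c r f g lv loc \<and>
          falls_into_starvation n c r f g lv loc"
      proof
        assume "int n - N \<le> int k"
        then show ?thesis
          using \<open>k \<le> n\<close> by (rule starving_if_ring_leaves)
      next
        assume "int n - (int n - N) \<le> int k"
        then show ?thesis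
          using \<open>k \<le> n\<close> by (rule M.starving_if_ring_leaves)
      qed
      then show False
        using resilient assms(4) unfolding resilient_to_def by blast
    qed
  next
    assume k: "int k < min N (int n - N)"
    show "resilient_to n c r k"
      unfolding resilient_to_def
    proof (intro allI impI, elim conjE)
      fix f' g' lv loc
      assume sync: "sync_schedule n c r f' g'" and lv: "dom lv \<subseteq> {..<n}" "card (dom lv) = k"
        and run: "is_run n c r f' g' lv loc"
      obtain A' N' where "scs_cycle n c r s f' g' A' N'"
        using scs_cycle_exists[OF assms(2) sync] by blast
      then interpret S: scs_cycle n c r s f' g' A' N' .
      \<comment> \<open>Resilience quantifies over all schedules; another one can at most swap the
        two ring sizes, which keeps their minimum.\<close>
      have "N' = N \<or> N' = int n - N"
        by (rule ring_size_unique) unfold_locales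
      then show "\<not> falls_into_starvation n c r f' g' lv loc"
        using lv k by (intro S.not_starving_if_few_leave[OF run]) auto
    qed
  qed
  have pos: "0 < min N (int n - N)"
    using N_pos M.N_pos by simp
  \<comment> \<open>Both sizes are positive, so 0 belongs to the set and \<open>nat\<close>
    truncates nothing.\<close>
  have "{k. k \<le> n \<and> resilient_to n c r k} = {..nat (min N (int n - N) - 1)}"
    using resilient N_pos M.N_pos by auto
  then have "isolation_resilience n c r = nat (min N (int n - N) - 1)"
    unfolding isolation_resilience_def by (simp only:) (intro Max_eqI, auto)
  then show ?thesis
    using ring_counts[OF assms(7,5)] pos by linarith
qed

end
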